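(* Let $V:\mathbb{R}^2\to\mathbb{R}$ be positive, continuous, and such that $V(x)\to+\infty$ as $|x|\to\infty$, and let $H_V := -\Delta+V(x)$ on $L^2(\mathbb{R}^2)$. Fix $\delta \in ]0,1[$ and $\rho \in ]0,1]$. Then, for $\lambda$ large enough, and for any nonzero real-valued eigenfunction $u$ of $H_V$ with $H_V u = \lambda u$, the length of $N(u) \cap B_V(\delta\lambda)$ is not less than $$\frac{2(1-\delta)}{9\pi^2j_{0,1}}\,\sqrt{\lambda} \; A\left( B_V^{(-2\rho)}(\delta\lambda)\right).$$
   Context: $N(u)$ is the nodal set of $u$, i.e. the closure of $\{u=0\}$. For $\mu>0$, $B_V(\mu) := \{ x \in \mathbb{R}^2 \mid V(x) < \mu \}$ and, for $r>0$, $B_V^{(-r)}(\mu) := \{ x\in \mathbb{R}^2 \mid B(x,r) \subset B_V(\mu)\}$, where $B(x,r)$ is the open ball with center $x$ and radius $r$. $A(\Omega)$ denotes the area of $\Omega$, and $j_{0,1}$ is the first positive zero of the Bessel function $J_0$. Length means one-dimensional Hausdorff measure. *)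

theory Defs
  imports "HOL-Analysis.Analysis"
begin

subsection \<open>Test functions and the operator\<close>

definition pderiv_at :: "'n::finite \<Rightarrow> (real^'n \<Rightarrow> real) \<Rightarrow> real^'n \<Rightarrow> real" where
  "pderiv_at i f x = frechet_derivative f (at x) (axis i 1)"

text \<open>Total differentiability of all iterated partial derivatives is the same as being
  \<open>C\<close>-infinity: it makes each of them continuous.\<close>

definition smooth_fun :: "(real^'n::finite \<Rightarrow> real) \<Rightarrow> bool" where
  "smooth_fun f \<longleftrightarrow> (\<forall>is. foldr pderiv_at is f differentiable_on UNIV)"

definition test_fun :: "(real^'n::finite \<Rightarrow> real) \<Rightarrow> bool" where
  "test_fun \<phi> \<longleftrightarrow> smooth_fun \<phi> \<and> compact (closure {x. \<phi> x \<noteq> 0})"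

definition laplacian :: "(real^'n::finite \<Rightarrow> real) \<Rightarrow> real^'n \<Rightarrow> real" where
  "laplacian f x = (\<Sum>i\<in>UNIV. pderiv_at i (pderiv_at i f) x)"

definition L2 :: "(real^'n::finite \<Rightarrow> real) set" where
  "L2 = {u \<in> borel_measurable lebesgue. integrable lebesgue (\<lambda>x. (u x)\<^sup>2)}"

text \<open>\<open>schroedinger_op V u f\<close> means that \<open>u\<close> lies in the domain of \<open>H\<^sub>V = - \<Delta> + V\<close> and that
  \<open>H\<^sub>V u = f\<close>. The domain consists of all \<open>u\<close> in \<open>L\<^sup>2\<close> for which the distribution
  \<open>- \<Delta> u + V u\<close> is in \<open>L\<^sup>2\<close>; this is the adjoint of \<open>- \<Delta> + V\<close> restricted to the test functions.
  For \<open>V\<close> continuous and bounded below that restriction is essentially self-adjoint, so this is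
  its closure, the unique self-adjoint realization. As \<open>V\<close> is real, it suffices to consider real
  functions.\<close>

definition schroedinger_op ::
    "(real^'n::finite \<Rightarrow> real) \<Rightarrow> (real^'n \<Rightarrow> real) \<Rightarrow> (real^'n \<Rightarrow> real) \<Rightarrow> bool" where
  "schroedinger_op V u f \<longleftrightarrow> u \<in> L2 \<and> f \<in> L2 \<and>
     (\<forall>\<phi>. test_fun \<phi> \<longrightarrow>
        (LINT x|lebesgue. u x * (- laplacian \<phi> x + V x * \<phi> x)) = (LINT x|lebesgue. f x * \<phi> x))"

text \<open>An eigenfunction is a class modulo null sets, represented here by its continuous
  representative, which exists by elliptic regularity; its zero set depends on that choice.
  No second derivatives are required: for \<open>V\<close> merely continuous, \<open>u\<close> need not be \<open>C\<^sup>2\<close>.\<close>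

definition eigenfunction ::
    "(real^'n::finite \<Rightarrow> real) \<Rightarrow> real \<Rightarrow> (real^'n \<Rightarrow> real) \<Rightarrow> bool" where
  "eigenfunction V lam u \<longleftrightarrow> continuous_on UNIV u \<and> \<not> (AE x in lebesgue. u x = 0) \<and>
     schroedinger_op V u (\<lambda>x. lam * u x)"

definition nodal_set :: "(real^'n::finite \<Rightarrow> real) \<Rightarrow> (real^'n) set" where
  "nodal_set u = closure {x. u x = 0}"


subsection \<open>Sublevel sets\<close>

definition B_V :: "(real^'n::finite \<Rightarrow> real) \<Rightarrow> real \<Rightarrow> (real^'n) set" where
  "B_V V \<mu> = {x. V x < \<mu>}"

text \<open>Written \<open>B\<^sub>V\<^bsup>(-r)\<^esup>(\<mu>)\<close> on paper.\<close>

definition B_V_inner :: "(real^'n::finite \<Rightarrow> real) \<Rightarrow> real \<Rightarrow> real \<Rightarrow> (real^'n) set" where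
  "B_V_inner V r \<mu> = {x. ball x r \<subseteq> B_V V \<mu>}"


subsection \<open>Length and the Bessel zero\<close>

text \<open>One-dimensional Hausdorff measure. Boundedness is required because \<^const>\<open>diameter\<close> is
  real-valued and meaningless on unbounded sets.\<close>

definition hausdorff_length :: "'a::metric_space set \<Rightarrow> ennreal" where
  "hausdorff_length S =
     (SUP d\<in>{0<..}. INF C\<in>{C :: nat \<Rightarrow> 'a set. S \<subseteq> (\<Union>i. C i) \<and>
                               (\<forall>i. bounded (C i) \<and> diameter (C i) \<le> d)}.
        \<Sum>i. ennreal (diameter (C i)))"

definition bessel_J0 :: "real \<Rightarrow> real" where
  "bessel_J0 x = (\<Sum>m. (-1) ^ m / (fact m)\<^sup>2 * (x / 2) ^ (2 * m))"

definition j01 :: real where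
  "j01 = (LEAST x. 0 < x \<and> bessel_J0 x = 0)"

end

theory Submission
  imports Defs
begin

text \<open>Where \<open>V < \<delta> \<lambda>\<close> one has \<open>\<lambda> - V > k\<close> with \<open>k = (1 - \<delta>) \<lambda>\<close>. The bump
  \<open>\<phi> = exp (- 1 / (1 - \<bar>x - c\<bar>\<^sup>2 / r\<^sup>2))\<close> satisfies \<open>- \<Delta> \<phi> \<le> (16 / r\<^sup>2) \<phi>\<close>, so testing the equation with it
  shows that \<open>u\<close> vanishes somewhere in every ball of radius \<open>r = 4 / \<surd>k\<close> in this region. If
  \<open>u(z) = 0\<close> and \<open>t < 2 / \<surd>\<lambda>\<close>, then \<open>u\<close> vanishes on the circle \<open>\<bar>x - z\<bar> = t\<close>: otherwise, up to sign,
  \<open>u > 0\<close> there, and with the supersolution \<open>w = 1 - \<lambda> \<bar>x - z\<bar>\<^sup>2 / 4\<close> and \<open>m = min (u / w) \<le> 0\<close> on the disc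
  the function \<open>u - m w\<close> is nonnegative, weakly superharmonic and zero at an interior point, which
  contradicts the strong minimum principle. As \<open>x \<mapsto> \<bar>x - z\<bar>\<close> is 1-Lipschitz, each such zero
  contributes length at least \<open>2 / \<surd>\<lambda>\<close> near \<open>z\<close>. One zero is taken in each square of side
  \<open>25 / (2 \<surd>k)\<close> that meets \<open>B\<^sub>V\<^bsup>(-2\<rho>)\<^esup>(\<delta> \<lambda>)\<close>. The constants leave room for the crude bounds
  \<open>j\<^sub>0\<^sub>,\<^sub>1 \<ge> 2\<close> and \<open>\<pi> \<ge> 3\<close>.\<close>

subsection \<open>Smooth functions of one variable\<close>

text \<open>\<open>n\<close>-fold differentiability, with the derivative existentially quantified at
  each stage, so that closure under sums, products and composition is a plain induction on
  \<open>n\<close>. Smoothness is expressed as \<open>Ck n S f\<close> for every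
  \<open>n\<close>.\<close>

fun Ck :: "nat \<Rightarrow> real set \<Rightarrow> (real \<Rightarrow> real) \<Rightarrow> bool" where
  "Ck 0 S f \<longleftrightarrow> True"
| "Ck (Suc n) S f \<longleftrightarrow> (\<exists>f'. (\<forall>x\<in>S. (f has_real_derivative f' x) (at x)) \<and> Ck n S f')"

lemma Ck_SucI:
  "(\<And>x. x \<in> S \<Longrightarrow> (f has_real_derivative f' x) (at x)) \<Longrightarrow> Ck n S f' \<Longrightarrow> Ck (Suc n) S f"
  by auto

lemma Ck_SucE:
  assumes "Ck (Suc n) S f"
  obtains f' where "\<forall>x\<in>S. (f has_real_derivative f' x) (at x)" "Ck n S f'"
  using assms by auto

declare Ck.simps(2) [simp del]

lemma Ck_SucD: "Ck (Suc n) S f \<Longrightarrow> Ck n S f"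
proof (induction n arbitrary: f)
  case (Suc n)
  obtain f' where "\<forall>x\<in>S. (f has_real_derivative f' x) (at x)" "Ck (Suc n) S f'"
    by (rule Ck_SucE[OF Suc.prems])
  then show ?case using Suc.IH[of f'] by (intro Ck_SucI[of S f f']) auto
qed simp

lemma Ck_cong:
  assumes "open S" "Ck n S f" "\<And>x. x \<in> S \<Longrightarrow> f x = g x"
  shows "Ck n S g"
proof (cases n)
  case (Suc m)
  obtain f' where "\<forall>x\<in>S. (f has_real_derivative f' x) (at x)" "Ck m S f'"
    by (rule Ck_SucE[OF assms(2)[unfolded Suc]])
  moreover have "(g has_real_derivative f' x) (at x)" if "x \<in> S" for x
    using bspec[OF calculation(1) that] assms that has_field_derivative_transform_within_open by blast
  ultimately show ?thesis unfolding Suc by (intro Ck_SucI[of S g f'])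
qed simp

lemma Ck_const: "Ck n S (\<lambda>x. c)"
proof (induction n arbitrary: c)
  case (Suc n)
  show ?case by (rule Ck_SucI[OF DERIV_const Suc])
qed simp

lemma Ck_ident: "Ck n S (\<lambda>x. x)"
proof (cases n)
  case (Suc m)
  show ?thesis unfolding Suc by (rule Ck_SucI[OF DERIV_ident Ck_const])
qed simp

lemma Ck_add: "Ck n S f \<Longrightarrow> Ck n S g \<Longrightarrow> Ck n S (\<lambda>x. f x + g x)"
proof (induction n arbitrary: f g)
  case (Suc n)
  obtain f' where f: "\<forall>x\<in>S. (f has_real_derivative f' x) (at x)" "Ck n S f'"
    by (rule Ck_SucE[OF Suc.prems(1)])
  obtain g' where g: "\<forall>x\<in>S. (g has_real_derivative g' x) (at x)" "Ck n S g'"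
    by (rule Ck_SucE[OF Suc.prems(2)])
  show ?case
    by (rule Ck_SucI[OF DERIV_add[OF f(1)[rule_format] g(1)[rule_format]] Suc.IH[OF f(2) g(2)]])
qed simp

lemma Ck_mult: "Ck n S f \<Longrightarrow> Ck n S g \<Longrightarrow> Ck n S (\<lambda>x. f x * g x)"
proof (induction n arbitrary: f g)
  case (Suc n)
  obtain f' where f: "\<forall>x\<in>S. (f has_real_derivative f' x) (at x)" "Ck n S f'"
    by (rule Ck_SucE[OF Suc.prems(1)])
  obtain g' where g: "\<forall>x\<in>S. (g has_real_derivative g' x) (at x)" "Ck n S g'"
    by (rule Ck_SucE[OF Suc.prems(2)])
  show ?case
  proof (rule Ck_SucI)
    show "((\<lambda>x. f x * g x) has_real_derivative f' x * g x + g' x * f x) (at x)" if "x \<in> S" for x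
      using f g that by (intro DERIV_mult) auto
    show "Ck n S (\<lambda>x. f' x * g x + g' x * f x)"
      by (rule Ck_add[OF Suc.IH[OF f(2) Ck_SucD[OF Suc.prems(2)]] Suc.IH[OF g(2) Ck_SucD[OF Suc.prems(1)]]])
  qed
qed simp

lemma Ck_compose: "Ck n T f \<Longrightarrow> Ck n S g \<Longrightarrow> g ` S \<subseteq> T \<Longrightarrow> Ck n S (\<lambda>x. f (g x))"
proof (induction n arbitrary: f)
  case (Suc n)
  obtain f' where f: "\<forall>x\<in>T. (f has_real_derivative f' x) (at x)" "Ck n T f'"
    by (rule Ck_SucE[OF Suc.prems(1)])
  obtain g' where g: "\<forall>x\<in>S. (g has_real_derivative g' x) (at x)" "Ck n S g'"
    by (rule Ck_SucE[OF Suc.prems(2)])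
  show ?case
  proof (rule Ck_SucI)
    show "((\<lambda>x. f (g x)) has_real_derivative f' (g x) * g' x) (at x)" if "x \<in> S" for x
      using f g that Suc.prems(3) by (intro DERIV_chain2) auto
    show "Ck n S (\<lambda>x. f' (g x) * g' x)"
      by (rule Ck_mult[OF Suc.IH[OF f(2) Ck_SucD[OF Suc.prems(2)] Suc.prems(3)] g(2)])
  qed
qed simp

text \<open>The derivative of \<open>inverse\<close> is a polynomial in \<open>inverse\<close>, so
  the induction hypothesis and \<open>Ck_mult\<close> close the induction step.\<close>

lemma Ck_inverse: "Ck n {0<..} inverse"
proof (induction n)
  case (Suc n)
  show ?case
  proof (rule Ck_SucI)
    show "(inverse has_real_derivative (-1) * (inverse x * inverse x)) (at x)" if "x \<in> {0<..}" for x :: real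
      using that by (auto intro!: derivative_eq_intros simp: power2_eq_square)
    show "Ck n {0<..} (\<lambda>x. (-1) * (inverse x * inverse x))"
      using Suc by (intro Ck_mult Ck_const)
  qed
qed simp

lemma Ck_ln: "Ck n {0<..} ln"
proof (cases n)
  case (Suc m)
  have "(ln has_real_derivative inverse x) (at x)" if "x \<in> {0<..}" for x
    using that by (auto intro!: derivative_eq_intros simp: divide_simps)
  then show ?thesis unfolding Suc using Ck_inverse[of m] by (rule Ck_SucI)
qed simp

text \<open>The powers of \<open>t\<close> are carried along because the linear span of this family
  is closed under differentiation (\<open>flat_deriv\<close>); smoothness across \<open>0\<close>
  then becomes an induction. \<open>flat 0\<close> is the profile of the bump.\<close>

definition flat :: "nat \<Rightarrow> real \<Rightarrow> real" where
  "flat m t = (if 0 < t then exp (- 1 / t) / t ^ m else 0)"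

lemma flat_nonneg: "0 \<le> flat m t"
  by (simp add: flat_def)

lemma flat_pos: "0 < t \<Longrightarrow> 0 < flat m t"
  by (simp add: flat_def)

text \<open>In the variable \<open>inverse t\<close> the limit from the right says that the
  exponential outgrows every power.\<close>

lemma flat_tendsto_0: "(flat m \<longlongrightarrow> 0) (at 0)"
proof -
  have "((\<lambda>t. inverse t ^ m / exp (inverse t)) \<longlongrightarrow> (0::real)) (at_right 0)"
    by (rule filterlim_compose[OF tendsto_power_div_exp_0 filterlim_inverse_at_top_right])
  then have "(flat m \<longlongrightarrow> 0) (at_right 0)"
    by (rule Lim_transform_eventually)
      (auto simp: eventually_at_right_field flat_def exp_minus field_simps intro!: exI[of _ 1])
  moreover have "(flat m \<longlongrightarrow> 0) (at_left 0)"
    by (rule tendsto_eventually) (auto simp: eventually_at_left_field flat_def intro!: exI[of _ "-1"])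
  ultimately show ?thesis by (simp add: filterlim_split_at)
qed

lemma flat_deriv: "(flat m has_real_derivative flat (m + 2) t - real m * flat (m + 1) t) (at t)"
proof -
  consider "t < 0" | "t = 0" | "0 < t" by linarith
  then show ?thesis
  proof cases
    case 1
    have "((\<lambda>_. 0) has_real_derivative 0) (at t)" by simp
    then have "(flat m has_real_derivative 0) (at t)"
      by (rule has_field_derivative_transform_within_open[of _ _ _ "{..<0}"])
        (use 1 in \<open>auto simp: flat_def\<close>)
    then show ?thesis using 1 by (simp add: flat_def)
  next
    case 2
    \<comment> \<open>At \<open>0\<close> the difference quotient of \<open>flat m\<close> is
      \<open>flat (Suc m)\<close>, which tends to \<open>0\<close>.\<close>
    have "((\<lambda>h. (flat m (0 + h) - flat m 0) / h) \<longlongrightarrow> 0) (at 0)"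
      by (rule Lim_transform_eventually[OF flat_tendsto_0[of "Suc m"]])
        (auto simp: flat_def eventually_at_filter)
    then show ?thesis using 2 by (simp add: DERIV_def flat_def)
  next
    case 3
    have "((\<lambda>t. exp (- 1 / t) / t ^ m) has_real_derivative
        exp (- 1 / t) / t ^ (m + 2) - real m * (exp (- 1 / t) / t ^ (m + 1))) (at t)"
    proof (cases m)
      case 0
      then show ?thesis using 3
        by (auto intro!: derivative_eq_intros simp: power2_eq_square divide_simps)
    next
      case (Suc k)
      have "((\<lambda>t. exp (- 1 / t) / t ^ m) has_real_derivative
          (exp (- 1 / t) * (1 / t\<^sup>2) * t ^ m - exp (- 1 / t) * (real m * t ^ k)) / (t ^ m * t ^ m)) (at t)"
        using 3 unfolding Suc by (auto simp del: power_Suc intro!: derivative_eq_intros simp: power2_eq_square)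
      then show ?thesis by (rule DERIV_cong) (use 3 in \<open>simp add: Suc field_simps power2_eq_square\<close>)
    qed
    then have "(flat m has_real_derivative
        exp (- 1 / t) / t ^ (m + 2) - real m * (exp (- 1 / t) / t ^ (m + 1))) (at t)"
      by (rule has_field_derivative_transform_within_open[of _ _ _ "{0<..}"])
        (use 3 in \<open>auto simp: flat_def\<close>)
    then show ?thesis using 3 by (simp add: flat_def)
  qed
qed

lemma Ck_flat: "Ck n S (flat m)"
proof (induction n arbitrary: m)
  case (Suc n)
  show ?case
  proof (rule Ck_SucI)
    show "(flat m has_real_derivative flat (m + 2) t + (- real m) * flat (m + 1) t) (at t)" for t
      using flat_deriv[of m] by simp
    show "Ck n S (\<lambda>t. flat (m + 2) t + (- real m) * flat (m + 1) t)"
      using Suc by (intro Ck_add Ck_mult Ck_const)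
  qed
qed simp

subsection \<open>Radial test functions\<close>

text \<open>The witness hidden in \<open>Ck (Suc n) S f\<close> may depend on \<open>n\<close>. By
  uniqueness of derivatives all witnesses agree on \<open>S\<close> with \<open>deriv f\<close>, and
  openness of \<open>S\<close> transfers their regularity to it.\<close>

lemma Ck_deriv:
  assumes "open S" "\<And>n. Ck n S f"
  shows "x \<in> S \<Longrightarrow> (f has_real_derivative deriv f x) (at x)" and "Ck n S (deriv f)"
proof -
  obtain f' where f': "\<forall>x\<in>S. (f has_real_derivative f' x) (at x)" "Ck n S f'"
    by (rule Ck_SucE[OF assms(2)[of "Suc n"]])
  then have eq: "f' x = deriv f x" if "x \<in> S" for x
    using that DERIV_imp_deriv[of f "f' x" x] by simp
  show "x \<in> S \<Longrightarrow> (f has_real_derivative deriv f x) (at x)"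
    using f'(1) eq by metis
  show "Ck n S (deriv f)"
    using Ck_cong[OF assms(1) f'(2) eq] .
qed

lemma pderiv_at_eq: "(f has_derivative f') (at x) \<Longrightarrow> pderiv_at i f x = f' (axis i 1)"
  unfolding pderiv_at_def by (metis frechet_derivative_at)

text \<open>A class that contains the radial functions and is closed under partial derivatives:
  differentiating a profile in the squared distance yields a coordinate times another profile, and
  the product rule stays inside. This reaches the iterated partial derivatives of every
  order.\<close>

inductive radial_smooth :: "real set \<Rightarrow> real^'n \<Rightarrow> (real^'n::finite \<Rightarrow> real) \<Rightarrow> bool"
  for S c where
  radial: "(\<And>n. Ck n S G) \<Longrightarrow> radial_smooth S c (\<lambda>x. G ((x - c) \<bullet> (x - c)))"
| add: "radial_smooth S c f \<Longrightarrow> radial_smooth S c g \<Longrightarrow> radial_smooth S c (\<lambda>x. f x + g x)"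
| scale: "radial_smooth S c f \<Longrightarrow> radial_smooth S c (\<lambda>x. a * f x)"
| coord: "radial_smooth S c f \<Longrightarrow> radial_smooth S c (\<lambda>x. (x - c) $ i * f x)"

lemma has_derivative_radial:
  assumes "(G has_real_derivative G') (at ((x - c) \<bullet> (x - c)))"
  shows "((\<lambda>x. G ((x - c) \<bullet> (x - c))) has_derivative (\<lambda>h. 2 * ((x - c) \<bullet> h) * G')) (at x)"
proof -
  have "((\<lambda>x. (x - c) \<bullet> (x - c)) has_derivative (\<lambda>h. 2 * ((x - c) \<bullet> h))) (at x)"
    by (auto intro!: derivative_eq_intros simp: inner_commute)
  from has_derivative_compose[OF this] assms show ?thesis
    by (simp add: has_field_derivative_def mult.commute)
qed

lemma pderiv_at_radial:
  assumes "(G has_real_derivative G') (at ((x - c) \<bullet> (x - c)))"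
  shows "pderiv_at i (\<lambda>x. G ((x - c) \<bullet> (x - c))) x = 2 * ((x - c) $ i * G')"
  by (subst pderiv_at_eq[OF has_derivative_radial[OF assms]]) (simp add: inner_axis)

lemma has_derivative_coord:
  fixes f :: "real^'n::finite \<Rightarrow> real"
  assumes "(f has_derivative f') (at x)"
  shows "((\<lambda>x. (x - c) $ i * f x) has_derivative (\<lambda>h. (x - c) $ i * f' h + h $ i * f x)) (at x)"
proof -
  have "((\<lambda>x. (x - c) $ i) has_derivative (\<lambda>h. h $ i)) (at x)"
    by (auto intro!: derivative_eq_intros bounded_linear_imp_has_derivative)
  from has_derivative_mult[OF this assms] show ?thesis .
qed

lemma radial_smooth_pderiv:
  assumes "open S" "\<And>x :: real^'n::finite. (x - c) \<bullet> (x - c) \<in> S" "radial_smooth S c f"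
  shows "(\<forall>x. f differentiable (at x)) \<and> (\<forall>i. radial_smooth S c (pderiv_at i f))"
  using assms(3)
proof (induction rule: radial_smooth.induct)
  case (radial G)
  have d: "(G has_real_derivative deriv G ((x - c) \<bullet> (x - c))) (at ((x - c) \<bullet> (x - c)))" for x
    using Ck_deriv(1)[OF assms(1) radial] assms(2) by blast
  have "pderiv_at i (\<lambda>x. G ((x - c) \<bullet> (x - c))) = (\<lambda>x. 2 * ((x - c) $ i * deriv G ((x - c) \<bullet> (x - c))))" for i
    by (intro ext pderiv_at_radial d)
  moreover have "radial_smooth S c (\<lambda>x. 2 * ((x - c) $ i * deriv G ((x - c) \<bullet> (x - c))))" for i
    by (intro radial_smooth.intros Ck_deriv(2)[OF assms(1) radial])
  ultimately show ?case using has_derivative_radial[OF d] unfolding differentiable_def by auto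
next
  case (add f g)
  obtain f' g' where d: "\<And>x. (f has_derivative f' x) (at x)" "\<And>x. (g has_derivative g' x) (at x)"
    using add.IH unfolding differentiable_def by metis
  then have "pderiv_at i (\<lambda>x. f x + g x) = (\<lambda>x. pderiv_at i f x + pderiv_at i g x)" for i
    using pderiv_at_eq[OF has_derivative_add[OF d]] pderiv_at_eq[OF d(1)] pderiv_at_eq[OF d(2)] by auto
  then show ?case using add.IH by (auto intro: radial_smooth.add differentiable_add)
next
  case (scale f a)
  obtain f' where d: "\<And>x. (f has_derivative f' x) (at x)"
    using scale.IH unfolding differentiable_def by metis
  then have "pderiv_at i (\<lambda>x. a * f x) = (\<lambda>x. a * pderiv_at i f x)" for i
    using pderiv_at_eq[OF has_derivative_mult_right[OF d]] pderiv_at_eq[OF d] by auto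
  then show ?case using scale.IH by (auto intro: radial_smooth.scale differentiable_mult)
next
  case (coord f j)
  obtain f' where d: "\<And>x. (f has_derivative f' x) (at x)"
    using coord.IH unfolding differentiable_def by metis
  have "pderiv_at i (\<lambda>x. (x - c) $ j * f x) =
      (\<lambda>x. (x - c) $ j * pderiv_at i f x + (if i = j then 1 else 0) * f x)" for i
    using pderiv_at_eq[OF has_derivative_coord[OF d]] pderiv_at_eq[OF d] by (auto simp: axis_def)
  moreover have "radial_smooth S c (\<lambda>x. (x - c) $ j * pderiv_at i f x + (if i = j then 1 else 0) * f x)" for i
    using coord by (intro radial_smooth.intros) auto
  moreover have "(\<lambda>x. (x - c) $ j * f x) differentiable (at x)" for x
    using has_derivative_coord[OF d] unfolding differentiable_def by blast
  ultimately show ?case by presburger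
qed

lemma smooth_fun_radial:
  assumes "open S" "\<And>x :: real^'n::finite. (x - c) \<bullet> (x - c) \<in> S" "\<And>n. Ck n S F"
  shows "smooth_fun (\<lambda>x. F ((x - c) \<bullet> (x - c)))"
  unfolding smooth_fun_def
proof
  fix js :: "'n list"
  have "radial_smooth S c (foldr pderiv_at js (\<lambda>x. F ((x - c) \<bullet> (x - c))))"
  proof (induction js)
    case Nil
    then show ?case by (simp add: radial_smooth.radial assms(3))
  next
    case (Cons i js)
    then show ?case using radial_smooth_pderiv[OF assms(1,2)] by auto
  qed
  then show "foldr pderiv_at js (\<lambda>x. F ((x - c) \<bullet> (x - c))) differentiable_on UNIV"
    using radial_smooth_pderiv[OF assms(1,2)] by (auto simp: differentiable_on_def)
qed

text \<open>Profiles depend on the squared distance, which unlike the distance is smooth at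
  \<open>c\<close>. They must be smooth slightly below \<open>0\<close> because the derivatives at
  \<open>0\<close> are two-sided.\<close>

lemma test_fun_radial:
  assumes "0 < e" "\<And>n. Ck n {-e<..} F" "\<And>s. R\<^sup>2 \<le> s \<Longrightarrow> F s = 0" "0 < R"
  shows "test_fun (\<lambda>x :: real^'n::finite. F ((x - c) \<bullet> (x - c)))"
  unfolding test_fun_def
proof
  show "smooth_fun (\<lambda>x. F ((x - c) \<bullet> (x - c)))"
    using assms by (intro smooth_fun_radial[of "{-e<..}"]) (auto intro: less_le_trans[of _ 0])
  have "{x. F ((x - c) \<bullet> (x - c)) \<noteq> 0} \<subseteq> cball c R"
  proof
    fix x assume "x \<in> {x. F ((x - c) \<bullet> (x - c)) \<noteq> 0}"
    then have "(norm (x - c))\<^sup>2 < R\<^sup>2" using assms(3)[of "(x - c) \<bullet> (x - c)"] by (auto simp: power2_norm_eq_inner not_le[symmetric])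
    then have "norm (x - c) < R" using assms(4) by (simp add: power2_less_imp_less)
    then show "x \<in> cball c R" by (simp add: dist_norm norm_minus_commute)
  qed
  then have "bounded {x. F ((x - c) \<bullet> (x - c)) \<noteq> 0}" by (rule bounded_subset[OF bounded_cball])
  then show "compact (closure {x. F ((x - c) \<bullet> (x - c)) \<noteq> 0})" by simp
qed

text \<open>The second partial in direction \<open>i\<close> is
  \<open>4 * ((x - c) $ i)^2 * F'' + 2 * F'\<close>; summing over the two directions of the plane
  gives the factor \<open>4\<close> of \<open>F'\<close>.\<close>

lemma laplacian_radial:
  fixes x c :: "real^2"
  assumes "\<And>s. 0 \<le> s \<Longrightarrow> (F has_real_derivative F' s) (at s)"
    and "\<And>s. 0 \<le> s \<Longrightarrow> (F' has_real_derivative F'' s) (at s)"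
  shows "laplacian (\<lambda>x. F ((x - c) \<bullet> (x - c))) x
    = 4 * F' ((x - c) \<bullet> (x - c)) + 4 * ((x - c) \<bullet> (x - c)) * F'' ((x - c) \<bullet> (x - c))"
proof -
  let ?s = "(x - c) \<bullet> (x - c)"
  have 1: "pderiv_at i (\<lambda>x. F ((x - c) \<bullet> (x - c))) = (\<lambda>x. 2 * ((x - c) $ i * F' ((x - c) \<bullet> (x - c))))" for i
    by (intro ext pderiv_at_radial assms) simp
  have "((\<lambda>x. 2 * ((x - c) $ i * F' ((x - c) \<bullet> (x - c)))) has_derivative
      (\<lambda>h. 2 * ((x - c) $ i * (2 * ((x - c) \<bullet> h) * F'' ?s) + h $ i * F' ?s))) (at x)" for i
    by (intro has_derivative_mult_right has_derivative_coord has_derivative_radial assms) simp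
  then have "pderiv_at i (pderiv_at i (\<lambda>x. F ((x - c) \<bullet> (x - c)))) x =
      4 * ((x - c) $ i * (x - c) $ i) * F'' ?s + 2 * F' ?s" for i
    unfolding 1 by (subst pderiv_at_eq) (assumption, simp add: inner_axis algebra_simps)
  then show ?thesis
    unfolding laplacian_def by (simp add: sum_2 inner_vec_def algebra_simps)
qed

subsection \<open>Integration by parts\<close>

lemma borel_integrable_compact_support:
  fixes f :: "'a::euclidean_space \<Rightarrow> real"
  assumes "continuous_on UNIV f" "compact K" "\<And>x. x \<notin> K \<Longrightarrow> f x = 0"
  shows "integrable lborel f"
proof -
  have "integrable lborel (\<lambda>x. indicator K x *\<^sub>R f x)"
    using assms by (intro borel_integrable_compact continuous_on_subset[OF assms(1)]) auto
  moreover have "(\<lambda>x. indicator K x *\<^sub>R f x) = f"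
    using assms(3) by (auto simp: fun_eq_iff indicator_def)
  ultimately show ?thesis by simp
qed

lemma integrable_compact_support:
  fixes f :: "'a::euclidean_space \<Rightarrow> real"
  assumes "continuous_on UNIV f" "compact K" "\<And>x. x \<notin> K \<Longrightarrow> f x = 0"
  shows "integrable lebesgue f"
  using borel_integrable_compact_support[OF assms]
  by (simp add: integrable_completion)

lemma lborel_integral_shift:
  fixes f :: "'a::euclidean_space \<Rightarrow> real"
  assumes "f \<in> borel_measurable borel"
  shows "(LINT x|lborel. f (x + c)) = (LINT x|lborel. f x)"
proof -
  have "(LINT x|lborel. f x) = (LINT x|distr lborel borel ((+) c). f x)"
    by (simp add: lborel_distr_plus)
  also have "\<dots> = (LINT x|lborel. f (c + x))"
    using assms by (intro integral_distr) auto
  finally show ?thesis by (simp add: add.commute)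
qed

lemma has_real_derivative_line:
  assumes "f differentiable (at (x + t *\<^sub>R axis i 1))"
  shows "((\<lambda>t. f (x + t *\<^sub>R axis i 1)) has_real_derivative
    pderiv_at i f (x + t *\<^sub>R axis i 1)) (at t)"
proof -
  obtain f' where f': "(f has_derivative f') (at (x + t *\<^sub>R axis i 1))"
    using assms unfolding differentiable_def by auto
  interpret linear f' using f' has_derivative_linear by blast
  have "((\<lambda>t. x + t *\<^sub>R axis i 1) has_derivative (\<lambda>h. h *\<^sub>R axis i 1)) (at t)"
    by (auto intro!: derivative_eq_intros)
  from has_derivative_compose[OF this f'] show ?thesis
    by (simp add: has_field_derivative_def pderiv_at_eq[OF f'] scale mult_commute_abs)
qed

lemma pderiv_at_eq_0:
  assumes "open S" "x \<in> S" "\<And>y. y \<in> S \<Longrightarrow> f y = 0"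
  shows "pderiv_at i f x = 0"
proof -
  have "(f has_derivative (\<lambda>_. 0)) (at x)"
    by (rule has_derivative_transform_within_open[of "\<lambda>_. 0" _ _ _ S]) (use assms in auto)
  from pderiv_at_eq[OF this] show ?thesis .
qed

text \<open>By translation invariance the difference quotients of \<open>f\<close> in direction
  \<open>i\<close> have integral zero, and dominated convergence passes this to the partial
  derivative. No iterated integrals are involved.\<close>

lemma integral_pderiv_at_eq_0:
  fixes f :: "real^'n::finite \<Rightarrow> real"
  assumes diff: "\<And>x. f differentiable (at x)" and cont: "continuous_on UNIV (pderiv_at i f)"
    and "compact K" and supp: "\<And>x. x \<notin> K \<Longrightarrow> f x = 0"
  shows "(LINT x|lebesgue. pderiv_at i f x) = 0"
proof -
  define e :: "real^'n" where "e = axis i 1"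
  define h :: "nat \<Rightarrow> real" where "h n = inverse (real (Suc n))" for n
  define q where "q n x = (f (x + h n *\<^sub>R e) - f x) / h n" for n x
  have e: "norm e = 1" by (simp add: e_def)
  have h: "0 < h n" "h n \<le> 1" for n by (auto simp: h_def field_simps)
  have fcont: "continuous_on UNIV f"
    using diff by (simp add: continuous_on_eq_continuous_within differentiable_imp_continuous_within)
  have fint: "integrable lborel f"
    by (rule borel_integrable_compact_support[OF fcont \<open>compact K\<close> supp])
  have psupp: "pderiv_at i f x = 0" if "x \<notin> K" for x
    by (rule pderiv_at_eq_0[of "- K"]) (use that supp \<open>compact K\<close> compact_imp_closed in auto)
  obtain M where M: "\<And>x. x \<in> K \<Longrightarrow> \<bar>pderiv_at i f x\<bar> \<le> M" "0 \<le> M"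
  proof -
    have "bounded (pderiv_at i f ` K)"
      by (intro compact_imp_bounded compact_continuous_image continuous_on_subset[OF cont] \<open>compact K\<close>) auto
    then obtain B where "\<And>x. x \<in> K \<Longrightarrow> \<bar>pderiv_at i f x\<bar> \<le> B" "0 < B"
      unfolding bounded_pos by auto
    then show thesis using that[of B] by auto
  qed
  have pM: "\<bar>pderiv_at i f x\<bar> \<le> M" for x using M psupp[of x] by (cases "x \<in> K") auto
  obtain R where R: "\<And>x. x \<in> K \<Longrightarrow> norm x \<le> R"
    using compact_imp_bounded[OF \<open>compact K\<close>] unfolding bounded_iff by auto
  \<comment> \<open>The dominating function: the mean value theorem bounds the quotient by
    \<open>M\<close>, and outside the ball of radius \<open>R + 1\<close> both evaluation points
    miss \<open>K\<close>, as the increment is at most \<open>1\<close>.\<close>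
  have qb: "norm (q n x) \<le> M * indicator (cball 0 (R + 1)) x" for n x
  proof (cases "norm x \<le> R + 1")
    case True
    obtain t where "f (x + h n *\<^sub>R e) - f (x + 0 *\<^sub>R e) = (h n - 0) * pderiv_at i f (x + t *\<^sub>R e)"
      using MVT2[OF h(1)[of n], of "\<lambda>t. f (x + t *\<^sub>R e)" "\<lambda>t. pderiv_at i f (x + t *\<^sub>R e)"]
        has_real_derivative_line[OF diff] unfolding e_def by blast
    then have "q n x = pderiv_at i f (x + t *\<^sub>R e)" using h(1)[of n] by (simp add: q_def)
    then show ?thesis using True pM by simp
  next
    case False
    have "norm x \<le> norm (x + h n *\<^sub>R e) + norm (h n *\<^sub>R e)" by (metis add_diff_cancel norm_triangle_ineq4)
    then have "R < norm (x + h n *\<^sub>R e)" "R < norm x" using False h[of n] e by auto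
    then have "x + h n *\<^sub>R e \<notin> K" "x \<notin> K" using R by force+
    then show ?thesis using supp False by (simp add: q_def)
  qed
  have fb: "f \<in> borel_measurable borel" "pderiv_at i f \<in> borel_measurable borel"
    using fcont cont by (auto intro: borel_measurable_continuous_onI)
  have shift_int: "integrable lborel (\<lambda>x. f (x + h n *\<^sub>R e))" for n
  proof -
    have "integrable (distr lborel borel ((+) (h n *\<^sub>R e))) f" using fint by (simp add: lborel_distr_plus)
    then show ?thesis by (subst (asm) integrable_distr_eq) (use fb in \<open>auto simp: add.commute\<close>)
  qed
  have "(\<lambda>n. LINT x|lborel. q n x) \<longlonglongrightarrow> (LINT x|lborel. pderiv_at i f x)"
  proof (rule integral_dominated_convergence[where w = "\<lambda>x. M * indicator (cball 0 (R + 1)) x"])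
    show "q n \<in> borel_measurable lborel" for n
      unfolding q_def using fb by measurable
    show "integrable lborel (\<lambda>x. M * indicator (cball 0 (R + 1)) x)"
      by (intro integrable_mult_right integrable_real_indicator) (use emeasure_compact_finite[OF compact_cball, of 0 "R + 1"] in auto)
    show "AE x in lborel. (\<lambda>n. q n x) \<longlonglongrightarrow> pderiv_at i f x"
    proof (rule AE_I2)
      fix x :: "real^'n"
      have "((\<lambda>t. (f (x + (0 + t) *\<^sub>R e) - f (x + 0 *\<^sub>R e)) / t) \<longlongrightarrow> pderiv_at i f (x + 0 *\<^sub>R e)) (at 0)"
        using has_real_derivative_line[OF diff, where x = x and t = 0 and i = i] unfolding DERIV_def e_def .
      moreover have "filterlim h (at 0) sequentially"
        unfolding filterlim_at h_def using LIMSEQ_inverse_real_of_nat by auto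
      ultimately show "(\<lambda>n. q n x) \<longlonglongrightarrow> pderiv_at i f x"
        unfolding q_def by (auto dest: filterlim_compose)
    qed
  qed (use qb fb in auto)
  moreover have "(LINT x|lborel. q n x) = 0" for n
    unfolding q_def using shift_int fint fb(1) by (simp add: lborel_integral_shift)
  ultimately have "(LINT x|lborel. pderiv_at i f x) = 0" by (simp add: LIMSEQ_const_iff)
  then show ?thesis using fb(2) by (simp add: integral_completion)
qed

lemma smooth_funD:
  assumes "smooth_fun f"
  shows "f differentiable (at x)" "continuous_on UNIV f"
    and "smooth_fun (pderiv_at i f)"
proof -
  have d: "foldr pderiv_at js f differentiable_on UNIV" for js
    using assms unfolding smooth_fun_def by blast
  show "f differentiable (at x)" using d[of "[]"] by (simp add: differentiable_on_def)
  show "continuous_on UNIV f" using d[of "[]"] by (simp add: differentiable_imp_continuous_on)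
  show "smooth_fun (pderiv_at i f)"
    unfolding smooth_fun_def
  proof
    fix js show "foldr pderiv_at js (pderiv_at i f) differentiable_on UNIV"
      using d[of "js @ [i]"] by simp
  qed
qed

lemma test_funD:
  assumes "test_fun f"
  obtains K where "compact K" "\<And>x. x \<notin> K \<Longrightarrow> f x = 0" "\<And>i x. x \<notin> K \<Longrightarrow> pderiv_at i f x = 0"
    "\<And>i j x. x \<notin> K \<Longrightarrow> pderiv_at j (pderiv_at i f) x = 0" "\<And>x. x \<notin> K \<Longrightarrow> laplacian f x = 0"
proof
  let ?K = "closure {x. f x \<noteq> 0}"
  show "compact ?K" using assms unfolding test_fun_def by simp
  show 0: "f x = 0" if "x \<notin> ?K" for x
    using that closure_subset[of "{x. f x \<noteq> 0}"] by auto
  show 1: "pderiv_at i f x = 0" if "x \<notin> ?K" for i x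
    using that by (intro pderiv_at_eq_0[of "- ?K"] 0) (auto simp: open_Compl)
  show 2: "pderiv_at j (pderiv_at i f) x = 0" if "x \<notin> ?K" for i j x
    using that by (intro pderiv_at_eq_0[of "- ?K"] 1) (auto simp: open_Compl)
  show "laplacian f x = 0" if "x \<notin> ?K" for x
    using 2[OF that] by (simp add: laplacian_def)
qed

lemma continuous_on_laplacian: "smooth_fun f \<Longrightarrow> continuous_on UNIV (laplacian f)"
  unfolding laplacian_def by (intro continuous_intros smooth_funD(2) smooth_funD(3))

lemma integrable_times_compact_support:
  fixes g :: "'a::euclidean_space \<Rightarrow> real"
  assumes "continuous_on UNIV g" "continuous_on UNIV f" "compact K" "\<And>x. x \<notin> K \<Longrightarrow> f x = 0"
  shows "integrable lebesgue (\<lambda>x. g x * f x)"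
  using assms by (intro integrable_compact_support[of _ K] continuous_intros) auto

lemma integrable_test_fun:
  assumes "test_fun f" "continuous_on UNIV g"
  shows "integrable lebesgue (\<lambda>x. g x * f x)" "integrable lebesgue (\<lambda>x. g x * laplacian f x)"
proof -
  obtain K where "compact K" "\<And>x. x \<notin> K \<Longrightarrow> f x = 0" "\<And>x. x \<notin> K \<Longrightarrow> laplacian f x = 0"
    using test_funD[OF assms(1)] by metis
  then show "integrable lebesgue (\<lambda>x. g x * f x)" "integrable lebesgue (\<lambda>x. g x * laplacian f x)"
    using assms(1) integrable_times_compact_support[OF assms(2), of _ K]
    by (auto simp: test_fun_def smooth_funD(2) continuous_on_laplacian)
qed

text \<open>Green's identity against a quadratic polynomial \<open>w\<close> with Laplacian
  \<open>4 * b\<close>: the i-th component \<open>p i\<close> of the field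
  \<open>w grad f - f grad w\<close> has i-th partial
  \<open>w * pderiv_at i (pderiv_at i f) - 2 * b * f\<close>, whose integral vanishes.\<close>

lemma integral_quadratic_laplacian:
  fixes f :: "real^2 \<Rightarrow> real" and z :: "real^2"
  assumes "test_fun f"
  shows "(LINT x|lebesgue. (a + b * ((x - z) \<bullet> (x - z))) * laplacian f x) = 4 * b * (LINT x|lebesgue. f x)"
proof -
  have sm: "smooth_fun f" using assms by (simp add: test_fun_def)
  obtain K where K: "compact K" "\<And>x. x \<notin> K \<Longrightarrow> f x = 0" "\<And>i x. x \<notin> K \<Longrightarrow> pderiv_at i f x = 0"
      "\<And>i j x. x \<notin> K \<Longrightarrow> pderiv_at j (pderiv_at i f) x = 0"
    using test_funD[OF assms] by metis
  define w where "w x = a + b * ((x - z) \<bullet> (x - z))" for x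
  define p where "p i x = w x * pderiv_at i f x - 2 * b * ((x - z) $ i * f x)" for i x
  have cw: "continuous_on UNIV w" unfolding w_def by (intro continuous_intros)
  have cc: "continuous_on UNIV (\<lambda>x. (x - z) $ i)" for i by (intro continuous_intros)
  note cf = smooth_funD(2)[OF sm] smooth_funD(2)[OF smooth_funD(3)[OF sm]]
    smooth_funD(2)[OF smooth_funD(3)[OF smooth_funD(3)[OF sm]]]
  obtain f' where f': "\<And>x. (f has_derivative f' x) (at x)"
    using smooth_funD(1)[OF sm] unfolding differentiable_def by metis
  have "\<exists>g'. \<forall>x. (pderiv_at i f has_derivative g' x) (at x)" for i
    using smooth_funD(1)[OF smooth_funD(3)[OF sm]] unfolding differentiable_def by metis
  then obtain g' where g': "\<And>i x. (pderiv_at i f has_derivative g' i x) (at x)" by metis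
  have dw: "(w has_derivative (\<lambda>h. 2 * ((x - z) \<bullet> h) * b)) (at x)" for x
    unfolding w_def by (rule has_derivative_radial) (auto intro!: derivative_eq_intros)
  have dp: "(p i has_derivative (\<lambda>h. w x * g' i x h + 2 * ((x - z) \<bullet> h) * b * pderiv_at i f x
      - 2 * b * ((x - z) $ i * f' x h + h $ i * f x))) (at x)" for i x
    unfolding p_def
    by (intro has_derivative_diff has_derivative_mult[OF dw g'] has_derivative_mult_right
        has_derivative_coord f')
  have pp: "pderiv_at i (p i) x = w x * pderiv_at i (pderiv_at i f) x - 2 * b * f x" for i x
    unfolding pderiv_at_eq[OF dp] pderiv_at_eq[OF g'] pderiv_at_eq[OF f', symmetric]
    by (simp add: inner_axis algebra_simps)
  have int1: "integrable lebesgue (\<lambda>x. w x * pderiv_at i (pderiv_at i f) x)" for i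
    by (rule integrable_times_compact_support[OF cw cf(3) K(1,4)])
  have int2: "integrable lebesgue (\<lambda>x. 2 * b * f x)"
    by (rule integrable_times_compact_support[OF _ cf(1) K(1,2)]) simp_all
  have "(LINT x|lebesgue. w x * pderiv_at i (pderiv_at i f) x) = 2 * b * (LINT x|lebesgue. f x)" for i
  proof -
    have "(LINT x|lebesgue. pderiv_at i (p i) x) = 0"
    proof (rule integral_pderiv_at_eq_0[OF _ _ K(1)])
      show "p i differentiable (at x)" for x using dp unfolding differentiable_def by blast
      show "continuous_on UNIV (pderiv_at i (p i))"
        unfolding pp by (intro continuous_intros cw cf)
      show "p i x = 0" if "x \<notin> K" for x using K that by (simp add: p_def)
    qed
    then show ?thesis unfolding pp using int1[of i] int2 by simp
  qed
  moreover have "(LINT x|lebesgue. w x * laplacian f x)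
      = (\<Sum>i\<in>UNIV. LINT x|lebesgue. w x * pderiv_at i (pderiv_at i f) x)"
    unfolding laplacian_def sum_distrib_left using int1 by (subst Bochner_Integration.integral_sum) auto
  ultimately show ?thesis unfolding w_def by simp
qed

subsection \<open>Zeros in small balls\<close>

text \<open>The weak equation with the Laplacian isolated. Splitting the integral is legitimate
  because \<open>u\<close> and \<open>V\<close> are continuous and \<open>f\<close> has compact
  support.\<close>

lemma eigenfunction_weak:
  fixes V u :: "real^2 \<Rightarrow> real"
  assumes "eigenfunction V lam u" "continuous_on UNIV V" "test_fun f"
  shows "(LINT x|lebesgue. u x * laplacian f x) = (LINT x|lebesgue. ((V x - lam) * u x) * f x)"
proof -
  have cu: "continuous_on UNIV u" using assms(1) by (simp add: eigenfunction_def)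
  have "(LINT x|lebesgue. u x * (- laplacian f x + V x * f x)) = (LINT x|lebesgue. lam * u x * f x)"
    using assms unfolding eigenfunction_def schroedinger_op_def by blast
  moreover have "(\<lambda>x. u x * (- laplacian f x + V x * f x)) = (\<lambda>x. (V x * u x) * f x - u x * laplacian f x)"
    by (simp add: fun_eq_iff algebra_simps)
  moreover have "(LINT x|lebesgue. (V x * u x) * f x - u x * laplacian f x)
      = (LINT x|lebesgue. (V x * u x) * f x) - (LINT x|lebesgue. u x * laplacian f x)"
    by (intro Bochner_Integration.integral_diff integrable_test_fun assms continuous_intros cu)
  moreover have "(LINT x|lebesgue. (V x * u x) * f x - (lam * u x) * f x)
      = (LINT x|lebesgue. (V x * u x) * f x) - (LINT x|lebesgue. lam * u x * f x)"
    by (intro Bochner_Integration.integral_diff integrable_test_fun assms continuous_intros cu)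
  ultimately show ?thesis by (simp add: algebra_simps)
qed

text \<open>Lets the sign arguments below treat positive \<open>u\<close> only.\<close>

lemma eigenfunction_uminus:
  assumes "eigenfunction V lam u"
  shows "eigenfunction V lam (\<lambda>x. - u x)"
  using assms unfolding eigenfunction_def schroedinger_op_def L2_def
  by (auto intro: continuous_on_minus)

text \<open>The set where \<open>f\<close> does not vanish is negligible and, by continuity, open,
  hence empty.\<close>

lemma nonneg_continuous_integral_eq_0:
  fixes f :: "'a::euclidean_space \<Rightarrow> real"
  assumes "continuous_on UNIV f" "\<And>x. 0 \<le> f x" "integrable lebesgue f" "(LINT x|lebesgue. f x) \<le> 0"
  shows "f x = 0"
proof -
  have "(LINT x|lebesgue. f x) = 0" using assms by (intro antisym integral_nonneg_AE) auto
  then have "AE x in lebesgue. f x = 0"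
    using assms by (subst (asm) integral_nonneg_eq_0_iff_AE) auto
  then have "negligible {x. f x \<noteq> 0}"
    unfolding negligible_iff_null_sets eventually_ae_filter_negligible
    by (metis (mono_tags, lifting) negligible_iff_null_sets negligible_subset)
  moreover have "open {x. f x \<noteq> 0}"
    using assms(1) by (auto intro: open_Collect_neq continuous_on_const)
  ultimately have "{x. f x \<noteq> 0} = {}" using open_not_negligible by blast
  then show ?thesis by auto
qed

text \<open>With \<open>y = 1 - s / r\<^sup>2\<close>, the sign rests on
  \<open>16 y\<^sup>4 + 4 y\<^sup>2 - 12 y + 4 = (2 y - 1)\<^sup>2 ((2 y + 1)\<^sup>2 + 3)\<close>.\<close>

lemma flat_laplacian_factor:
  assumes "0 \<le> s" "0 < r" "k * r\<^sup>2 = 16"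
  shows "0 \<le> 4 * (- 1 / r\<^sup>2 * flat 2 (1 - s / r\<^sup>2))
    + 4 * s * (1 / r\<^sup>2 * (1 / r\<^sup>2 * (flat 4 (1 - s / r\<^sup>2) - 2 * flat 3 (1 - s / r\<^sup>2))))
    + k * flat 0 (1 - s / r\<^sup>2)" (is "0 \<le> ?L")
proof (cases "0 < 1 - s / r\<^sup>2")
  case True
  define y where "y = 1 - s / r\<^sup>2"
  have y: "0 < y" using True by (simp add: y_def)
  have s: "s = r\<^sup>2 * (1 - y)" using assms by (simp add: y_def field_simps)
  have k: "k = 16 / r\<^sup>2" using assms by (simp add: field_simps)
  \<comment> \<open>A common factor \<open>exp (- 1 / y) / y ^ 4\<close> is taken out of all four
    values, which leaves a polynomial in \<open>y\<close>.\<close>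
  have fl: "flat 2 y = exp (- 1 / y) / y ^ 4 * y\<^sup>2" "flat 3 y = exp (- 1 / y) / y ^ 4 * y"
      "flat 4 y = exp (- 1 / y) / y ^ 4" "flat 0 y = exp (- 1 / y) / y ^ 4 * y ^ 4"
    using y by (auto simp: flat_def field_simps power2_eq_square power3_eq_cube power4_eq_xxxx)
  have alg1: "4 * (- 1 / q * A) + 4 * (q * (1 - y)) * (1 / q * (1 / q * B)) + 16 / q * C
      = 1 / q * (4 * (- A + (1 - y) * B) + 16 * C)" if "q \<noteq> 0" for q A B C :: real
    using that by (simp add: algebra_simps)
  have alg2: "1 / q * (4 * (- (E * y\<^sup>2) + (1 - y) * (E - 2 * (E * y))) + 16 * (E * y ^ 4))
      = 1 / q * E * ((2 * y - 1)\<^sup>2 * ((2 * y + 1)\<^sup>2 + 3))" for q E :: real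
    by (simp add: algebra_simps power2_eq_square power4_eq_xxxx)
  have "?L = 1 / r\<^sup>2 * (exp (- 1 / y) / y ^ 4) * ((2 * y - 1)\<^sup>2 * ((2 * y + 1)\<^sup>2 + 3))"
  proof -
    have "?L = 1 / r\<^sup>2 * (4 * (- flat 2 y + (1 - y) * (flat 4 y - 2 * flat 3 y)) + 16 * flat 0 y)"
      unfolding y_def[symmetric] unfolding s k using alg1[of "r\<^sup>2"] assms(2) by simp
    also have "\<dots> = 1 / r\<^sup>2 * (exp (- 1 / y) / y ^ 4) * ((2 * y - 1)\<^sup>2 * ((2 * y + 1)\<^sup>2 + 3))"
      unfolding fl alg2 ..
    finally show ?thesis .
  qed
  also have "0 \<le> \<dots>" using y by (intro mult_nonneg_nonneg) auto
  finally show ?thesis .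
qed (use assms in \<open>simp add: flat_def\<close>)

lemma eigenfunction_not_pos_on_ball:
  fixes V u :: "real^2 \<Rightarrow> real"
  assumes "eigenfunction V lam u" "continuous_on UNIV V" "0 < r" "k * r\<^sup>2 = 16"
    and V: "\<And>x. x \<in> ball c r \<Longrightarrow> k < lam - V x"
  shows "\<exists>x\<in>ball c r. u x \<le> 0"
proof (rule ccontr)
  assume "\<not> ?thesis"
  then have pos: "\<And>x. x \<in> ball c r \<Longrightarrow> 0 < u x" by force
  define F where "F s = flat 0 (1 - s / r\<^sup>2)" for s
  define F' where "F' s = - 1 / r\<^sup>2 * flat 2 (1 - s / r\<^sup>2)" for s
  define F'' where "F'' s = 1 / r\<^sup>2 * (1 / r\<^sup>2 * (flat 4 (1 - s / r\<^sup>2) - 2 * flat 3 (1 - s / r\<^sup>2)))" for s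
  define f where "f x = F ((x - c) \<bullet> (x - c))" for x
  have lin: "((\<lambda>s. 1 - s / r\<^sup>2) has_real_derivative - 1 / r\<^sup>2) (at s)" for s
    using DERIV_diff[OF DERIV_const[of 1] DERIV_cdivide[OF DERIV_ident, of "r\<^sup>2"], of s] by simp
  have flat0: "(flat 0 has_real_derivative flat 2 t) (at t)" for t
    using flat_deriv[of 0 t] by (simp add: numeral_2_eq_2)
  have flat2: "(flat 2 has_real_derivative flat 4 t - 2 * flat 3 t) (at t)" for t
    using flat_deriv[of 2 t] by simp
  have F': "(F has_real_derivative F' s) (at s)" for s
    unfolding F_def F'_def by (rule DERIV_cong[OF DERIV_chain2[OF flat0 lin]]) simp
  have F'': "(F' has_real_derivative F'' s) (at s)" for s
    unfolding F'_def F''_def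
    by (rule DERIV_cong[OF DERIV_cmult[OF DERIV_chain2[OF flat2 lin]]]) (simp only: minus_divide_left[symmetric] minus_mult_minus mult_minus_left mult_minus_right minus_minus mult_ac)
  have tf: "test_fun f"
    unfolding f_def
  proof (rule test_fun_radial[of 1 F r c])
    have "Ck n {- 1<..} (\<lambda>s. 1 + (- 1 / r\<^sup>2) * s)" for n
      by (intro Ck_add Ck_mult Ck_const Ck_ident)
    then have "Ck n {- 1<..} (\<lambda>s. 1 - s / r\<^sup>2)" for n by simp
    from Ck_compose[OF Ck_flat[of _ UNIV] this] show "Ck n {- 1<..} F" for n
      unfolding F_def by simp
    show "F s = 0" if "r\<^sup>2 \<le> s" for s
      using that assms(3) by (simp add: F_def flat_def)
  qed (use assms in auto)
  have lap: "laplacian f x = 4 * F' ((x - c) \<bullet> (x - c)) + 4 * ((x - c) \<bullet> (x - c)) * F'' ((x - c) \<bullet> (x - c))" for x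
    unfolding f_def by (rule laplacian_radial[OF F' F''])
  have ge: "0 \<le> laplacian f x + k * f x" for x
    unfolding lap f_def F_def F'_def F''_def using flat_laplacian_factor[OF _ assms(3,4)] by simp
  have f0: "0 \<le> f x" for x by (simp add: f_def F_def flat_nonneg)
  have zero: "f x = 0 \<and> laplacian f x = 0" if "x \<notin> ball c r" for x
  proof -
    have "r \<le> norm (x - c)" using that by (simp add: dist_norm norm_minus_commute)
    then have "r\<^sup>2 \<le> (x - c) \<bullet> (x - c)" using assms(3) by (simp flip: power2_norm_eq_inner)
    then show ?thesis using assms(3) by (simp add: f_def lap F_def F'_def F''_def flat_def)
  qed
  have cu: "continuous_on UNIV u" using assms(1) by (simp add: eigenfunction_def)
  \<comment> \<open>The weak equation makes the integral of \<open>g\<close> zero. In the regrouped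
    form \<open>g_eq\<close> both summands are nonnegative when \<open>u > 0\<close> on the ball,
    and the second is strictly positive at \<open>c\<close>, which is the contradiction.\<close>
  define g where "g x = u x * laplacian f x - ((V x - lam) * u x) * f x" for x
  have g_eq: "g x = u x * (laplacian f x + k * f x) + u x * (lam - V x - k) * f x" for x
    by (simp add: g_def algebra_simps)
  have int: "integrable lebesgue (\<lambda>x. u x * laplacian f x)"
      "integrable lebesgue (\<lambda>x. ((V x - lam) * u x) * f x)"
    by (intro integrable_test_fun tf continuous_intros cu assms)+
  have "g c = 0"
  proof (rule nonneg_continuous_integral_eq_0[of g c])
    show "continuous_on UNIV g"
      using tf unfolding g_def test_fun_def
      by (intro continuous_intros cu assms continuous_on_laplacian smooth_funD(2)) auto
    show "0 \<le> g x" for x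
    proof (cases "x \<in> ball c r")
      case True
      then show ?thesis unfolding g_eq using pos[of x] ge[of x] f0[of x] V[of x] by simp
    next
      case False
      then show ?thesis using zero[of x] by (simp add: g_def)
    qed
    show "integrable lebesgue g" unfolding g_def using int by simp
    show "(LINT x|lebesgue. g x) \<le> 0"
      unfolding g_def using int eigenfunction_weak[OF assms(1,2) tf] by simp
  qed
  moreover have "0 < f c" by (simp add: f_def F_def flat_pos)
  then have "0 < g c" unfolding g_eq using pos[of c] ge[of c] V[of c] assms(3)
    by (intro add_nonneg_pos mult_nonneg_nonneg mult_pos_pos) auto
  ultimately show False by simp
qed

lemma connected_nonzero_sign:
  fixes u :: "'a::topological_space \<Rightarrow> real"
  assumes "connected S" "continuous_on S u" "\<And>x. x \<in> S \<Longrightarrow> u x \<noteq> 0"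
  shows "(\<forall>x\<in>S. 0 < u x) \<or> (\<forall>x\<in>S. u x < 0)"
proof (rule ccontr)
  assume "\<not> ?thesis"
  then obtain x y where "x \<in> S" "y \<in> S" "u x \<le> 0" "0 \<le> u y" by (metis not_less)
  moreover have "connected (u ` S)" using assms(1,2) by (rule connected_continuous_image[rotated])
  ultimately have "0 \<in> u ` S" unfolding connected_iff_interval by blast
  then show False using assms(3) by auto
qed

lemma eigenfunction_zero_in_ball:
  fixes V u :: "real^2 \<Rightarrow> real"
  assumes "eigenfunction V lam u" "continuous_on UNIV V" "0 < r" "k * r\<^sup>2 = 16"
    and "\<And>x. x \<in> ball c r \<Longrightarrow> k < lam - V x"
  shows "\<exists>x\<in>ball c r. u x = 0"
proof (rule ccontr)
  assume no: "\<not> ?thesis"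
  have "continuous_on (ball c r) u"
    using assms(1) continuous_on_subset unfolding eigenfunction_def by blast
  with no have "(\<forall>x\<in>ball c r. 0 < u x) \<or> (\<forall>x\<in>ball c r. u x < 0)"
    by (intro connected_nonzero_sign) auto
  then show False
    using eigenfunction_not_pos_on_ball[OF assms]
      eigenfunction_not_pos_on_ball[OF eigenfunction_uminus[OF assms(1)] assms(2-5)] by force
qed

subsection \<open>The strong minimum principle\<close>

text \<open>The kernel is a quarter of minus the Laplacian of the smoothed logarithmic potential
  \<open>- ln (\<bar>x - c\<bar>\<^sup>2 + e)\<close>; summing over dyadic balls bounds its mass uniformly in \<open>e\<close>.\<close>

lemma newton_kernel_mass:
  fixes c :: "real^2"
  assumes "0 < e"
  shows "integrable lborel (\<lambda>x. e / ((x - c) \<bullet> (x - c) + e)\<^sup>2)"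
    and "(LINT x|lborel. e / ((x - c) \<bullet> (x - c) + e)\<^sup>2) \<le> 64 * pi / 3"
proof -
  let ?K = "\<lambda>x. e / ((x - c) \<bullet> (x - c) + e)\<^sup>2"
  \<comment> \<open>Let \<open>j\<close> be least with \<open>x\<close> in the ball of radius
    \<open>2 ^ j * sqrt e\<close>. For \<open>j > 0\<close> the point lies outside the preceding
    ball, so the denominator exceeds \<open>(4 ^ (j - 1) * e)^2\<close> and the kernel is at most
    \<open>16 / (e * 16 ^ j)\<close>; for \<open>j = 0\<close> it is at most
    \<open>1 / e\<close>.\<close>
  let ?T = "\<lambda>j x. ennreal (16 / (e * 16 ^ j)) * indicator (cball c (2 ^ j * sqrt e)) x"
  have four: "(2 ^ j)\<^sup>2 = (4::real) ^ j" "(4 ^ j)\<^sup>2 = (16::real) ^ j" for j :: nat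
    by (simp_all add: power2_eq_square flip: power_mult_distrib)
  have pow: "(2 ^ j * sqrt e)\<^sup>2 = 4 ^ j * e" for j :: nat
    using assms by (simp add: power_mult_distrib four)
  have meas: "?K \<in> borel_measurable lborel" by measurable
  have pt: "ennreal (?K x) \<le> (\<Sum>j. ?T j x)" for x
  proof -
    let ?s = "(x - c) \<bullet> (x - c)"
    have s0: "0 \<le> ?s" by simp
    have in_ball: "x \<in> cball c (2 ^ j * sqrt e) \<longleftrightarrow> ?s \<le> 4 ^ j * e" for j
    proof -
      have "x \<in> cball c (2 ^ j * sqrt e) \<longleftrightarrow> norm (x - c) \<le> 2 ^ j * sqrt e"
        by (simp add: dist_norm norm_minus_commute)
      also have "\<dots> \<longleftrightarrow> (norm (x - c))\<^sup>2 \<le> (2 ^ j * sqrt e)\<^sup>2"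
        using assms by (simp add: abs_le_square_iff[symmetric])
      also have "\<dots> \<longleftrightarrow> ?s \<le> 4 ^ j * e"
        by (simp add: power2_norm_eq_inner pow)
      finally show ?thesis .
    qed
    have "\<exists>j. ?s \<le> 4 ^ j * e"
    proof -
      obtain j where "?s / e < 4 ^ j" using real_arch_pow[of 4 "?s / e"] by auto
      then show ?thesis using assms by (auto simp: field_simps intro!: exI[of _ j])
    qed
    then have ex: "?s \<le> 4 ^ (LEAST j. ?s \<le> 4 ^ j * e) * e" by (rule LeastI_ex)
    define j where "j = (LEAST j. ?s \<le> 4 ^ j * e)"
    have "?K x \<le> 16 / (e * 16 ^ j)"
    proof (cases j)
      case 0
      have "e\<^sup>2 \<le> (?s + e)\<^sup>2" using assms s0 by (intro power_mono) auto
      then have "?K x \<le> e / e\<^sup>2" using assms s0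
        by (intro divide_left_mono mult_pos_pos zero_less_power) (auto intro: add_nonneg_pos)
      also have "\<dots> \<le> 16 / e" using assms by (simp add: field_simps power2_eq_square)
      finally show ?thesis using 0 by simp
    next
      case (Suc i)
      then have "\<not> ?s \<le> 4 ^ i * e" using not_less_Least[of i "\<lambda>j. ?s \<le> 4 ^ j * e"] by (simp add: j_def)
      then have "(4 ^ i * e)\<^sup>2 \<le> (?s + e)\<^sup>2" using assms by (intro power_mono) auto
      then have "?K x \<le> e / (4 ^ i * e)\<^sup>2" using assms s0
        by (intro divide_left_mono mult_pos_pos zero_less_power) (auto intro: add_nonneg_pos)
      also have "\<dots> = 1 / (e * 16 ^ i)"
        using assms by (simp add: power_mult_distrib four) (simp add: power2_eq_square)
      finally show ?thesis using Suc by simp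
    qed
    then have "ennreal (?K x) \<le> ?T j x"
      using in_ball[of j] ex by (simp add: j_def ennreal_leI)
    also have "\<dots> \<le> (\<Sum>j. ?T j x)"
      using sum_le_suminf[OF summableI, of "{j}" "\<lambda>j. ?T j x"]
      by (simp only: sum.insert[OF finite.emptyI] sum.empty empty_iff not_False_eq_True add_0_right
          finite.intros zero_le simp_thms)
    finally show ?thesis .
  qed
  have "(\<integral>\<^sup>+x. ?K x \<partial>lborel) \<le> (\<integral>\<^sup>+x. (\<Sum>j. ?T j x) \<partial>lborel)"
    by (intro nn_integral_mono pt)
  also have "\<dots> = (\<Sum>j. \<integral>\<^sup>+x. ?T j x \<partial>lborel)" 
    by (intro nn_integral_suminf borel_measurable_times_ennreal borel_measurable_const
        borel_measurable_indicator) simp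
  \<comment> \<open>The disc of index \<open>j\<close> has area \<open>pi * 4 ^ j * e\<close>, so
    the terms form a geometric series of ratio \<open>1 / 4\<close>.\<close>
  also have "\<dots> = (\<Sum>j. ennreal (16 * pi * (1 / 4) ^ j))"
  proof (intro suminf_cong)
    fix j
    have "(\<integral>\<^sup>+x. ?T j x \<partial>lborel) = ennreal (16 / (e * 16 ^ j)) * emeasure lborel (cball c (2 ^ j * sqrt e))"
      by (subst nn_integral_cmult_indicator) auto
    also have "\<dots> = ennreal (16 / (e * 16 ^ j) * (pi * (2 ^ j * sqrt e)\<^sup>2))"
      using assms by (subst emeasure_cball) (auto simp: unit_ball_vol_2 simp flip: ennreal_mult')
    also have "16 / (e * 16 ^ j) * (pi * (2 ^ j * sqrt e)\<^sup>2) = 16 * pi * (1 / 4) ^ j"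
      using assms by (simp add: pow field_simps power_divide flip: four(2)) (simp add: power2_eq_square flip: power_mult_distrib)
    finally show "(\<integral>\<^sup>+x. ?T j x \<partial>lborel) = ennreal (16 * pi * (1 / 4) ^ j)" .
  qed
  also have "\<dots> = ennreal (64 * pi / 3)"
    by (rule suminf_ennreal_eq) (use sums_mult[OF geometric_sums[of "1/4::real"], of "16 * pi"] in auto)
  finally have nn: "(\<integral>\<^sup>+x. ?K x \<partial>lborel) \<le> ennreal (64 * pi / 3)" .
  show int: "integrable lborel ?K"
    using nn assms meas by (intro integrableI_nonneg) (auto intro: le_less_trans)
  have "(\<integral>\<^sup>+x. ?K x \<partial>lborel) = ennreal (LINT x|lborel. ?K x)"
    using int assms by (intro nn_integral_eq_integral) auto
  with nn show "(LINT x|lborel. ?K x) \<le> 64 * pi / 3" by (simp add: ennreal_le_iff)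
qed

text \<open>A smooth convex cutoff that vanishes on the negative half line: composed with the smoothed
  logarithmic potential, it makes the support compact while adding only positive Laplacian.\<close>

definition hinge :: "real \<Rightarrow> real" where
  "hinge t = t * flat 0 t"

text \<open>As \<open>flat 0\<close> has derivative \<open>flat 2\<close> and \<open>flat 1\<close>
  has derivative \<open>flat 3 - flat 2\<close>, the \<open>flat 2\<close> terms cancel in the
  second derivative. What remains is nonnegative, which is the convexity.\<close>

lemma hinge_deriv:
  "(hinge has_real_derivative flat 0 t + flat 1 t) (at t)"
  "((\<lambda>t. flat 0 t + flat 1 t) has_real_derivative flat 3 t) (at t)"
proof -
  have "t * flat 2 t = flat 1 t" by (simp add: flat_def power2_eq_square)
  then show "(hinge has_real_derivative flat 0 t + flat 1 t) (at t)"
    unfolding hinge_def using DERIV_mult[OF DERIV_ident flat_deriv[of 0 t]]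
    by (simp add: add.commute mult.commute numeral_2_eq_2)
  show "((\<lambda>t. flat 0 t + flat 1 t) has_real_derivative flat 3 t) (at t)"
    by (rule DERIV_cong[OF DERIV_add[OF flat_deriv flat_deriv]]) (simp add: numeral_2_eq_2 numeral_3_eq_3)
qed

text \<open>The upper bound is \<open>1 + x \<le> exp x\<close> at \<open>x = 1 / t\<close>. It
  ensures that composing with the hinge does not amplify the negative part of the Laplacian.\<close>

lemma hinge_deriv_bounds: "0 \<le> flat 0 t + flat 1 t" "flat 0 t + flat 1 t \<le> 1"
proof -
  show "0 \<le> flat 0 t + flat 1 t" by (simp add: flat_nonneg)
  have "1 + 1 / t \<le> exp (1 / t)" by (rule exp_ge_add_one_self)
  then have "0 < t \<Longrightarrow> exp (- 1 / t) * (1 + 1 / t) \<le> 1" by (simp add: exp_minus field_simps)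
  then show "flat 0 t + flat 1 t \<le> 1" by (auto simp: flat_def algebra_simps)
qed

text \<open>\<open>W\<close> is the smoothed logarithmic potential shifted to vanish on the circle
  of radius \<open>R\<close>, where the hinge cuts it off. The Laplacian is a nonnegative term from
  the convexity of the hinge minus four times the kernel of \<open>newton_kernel_mass\<close>,
  weighted by the slope of the hinge.\<close>

lemma hinge_log_test_fun:
  fixes c :: "real^2"
  assumes "0 < e" "0 < R"
  defines "W \<equiv> \<lambda>s. ln (R\<^sup>2 + e) - ln (s + e)"
  defines "f \<equiv> \<lambda>x. hinge (W ((x - c) \<bullet> (x - c)))"
  shows "test_fun f" "0 \<le> f x" "R \<le> dist x c \<Longrightarrow> f x = 0"
    and "laplacian f x = 4 * ((x - c) \<bullet> (x - c)) * flat 3 (W ((x - c) \<bullet> (x - c))) / ((x - c) \<bullet> (x - c) + e)\<^sup>2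
      - 4 * e / ((x - c) \<bullet> (x - c) + e)\<^sup>2 * (flat 0 (W ((x - c) \<bullet> (x - c))) + flat 1 (W ((x - c) \<bullet> (x - c))))"
proof -
  have Wneg: "W s \<le> 0" if "R\<^sup>2 \<le> s" for s
  proof -
    have "0 < R\<^sup>2 + e" using assms by (simp add: add_nonneg_pos)
    then show ?thesis using that by (simp add: W_def)
  qed
  have hinge0: "hinge t = 0" if "t \<le> 0" for t using that by (simp add: hinge_def flat_def)
  show "0 \<le> f x" unfolding f_def by (auto simp: hinge_def flat_def)
  show "f x = 0" if "R \<le> dist x c"
  proof -
    have "R\<^sup>2 \<le> (norm (x - c))\<^sup>2" using that assms(2) by (intro power_mono) (auto simp: dist_norm)
    then show ?thesis unfolding f_def by (intro hinge0 Wneg) (simp add: power2_norm_eq_inner)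
  qed
  show "test_fun f"
    unfolding f_def
  proof (rule test_fun_radial[OF assms(1) _ _ assms(2)])
    show "hinge (W s) = 0" if "R\<^sup>2 \<le> s" for s by (intro hinge0 Wneg that)
    have "Ck n {- e<..} (\<lambda>s. ln (s + e))" for n
      by (rule Ck_compose[OF Ck_ln]) (auto intro!: Ck_add Ck_const Ck_ident)
    then have "Ck n {- e<..} (\<lambda>s. ln (R\<^sup>2 + e) + (- 1) * ln (s + e))" for n
      by (intro Ck_add Ck_mult Ck_const)
    then have W: "Ck n {- e<..} W" for n by (simp add: W_def)
    show "Ck n {- e<..} (\<lambda>s. hinge (W s))" for n
      unfolding hinge_def by (intro Ck_mult W Ck_compose[OF Ck_flat[of _ UNIV] W]) auto
  qed
  let ?F' = "\<lambda>s. (flat 0 (W s) + flat 1 (W s)) * (- 1 / (s + e))"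
  let ?F'' = "\<lambda>s. flat 3 (W s) * (- 1 / (s + e)) * (- 1 / (s + e)) + 1 / (s + e)\<^sup>2 * (flat 0 (W s) + flat 1 (W s))"
  have W': "(W has_real_derivative - 1 / (s + e)) (at s)" if "0 \<le> s" for s
    unfolding W_def using that assms(1) by (auto intro!: derivative_eq_intros)
  have F': "((\<lambda>s. hinge (W s)) has_real_derivative ?F' s) (at s)" if "0 \<le> s" for s
    by (rule DERIV_chain2[OF hinge_deriv(1) W'[OF that]])
  have "((\<lambda>s. - 1 / (s + e)) has_real_derivative 1 / (s + e)\<^sup>2) (at s)" if "0 \<le> s" for s
    using that assms(1) by (auto intro!: derivative_eq_intros simp: power2_eq_square)
  then have F'': "(?F' has_real_derivative ?F'' s) (at s)" if "0 \<le> s" for s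
    by (intro DERIV_mult DERIV_chain2[OF hinge_deriv(2) W'[OF that]]) (use that in auto)
  have alg: "4 * (G * (- 1 / (s + e))) + 4 * s * (H * (- 1 / (s + e)) * (- 1 / (s + e)) + 1 / (s + e)\<^sup>2 * G)
      = 4 * s * H / (s + e)\<^sup>2 - 4 * e / (s + e)\<^sup>2 * G" if "0 \<le> s" for s G H
  proof -
    have "s + e \<noteq> 0" using that assms(1) by simp
    then show ?thesis by (simp add: divide_simps power2_eq_square) (simp add: algebra_simps)
  qed
  show "laplacian f x = 4 * ((x - c) \<bullet> (x - c)) * flat 3 (W ((x - c) \<bullet> (x - c))) / ((x - c) \<bullet> (x - c) + e)\<^sup>2
      - 4 * e / ((x - c) \<bullet> (x - c) + e)\<^sup>2 * (flat 0 (W ((x - c) \<bullet> (x - c))) + flat 1 (W ((x - c) \<bullet> (x - c))))"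
    unfolding f_def by (rule trans[OF laplacian_radial[where F' = ?F' and F'' = ?F'', OF F' F''] alg]) auto
qed

text \<open>If \<open>v y > 0\<close>, the cut-off potential with pole \<open>c\<close> contradicts
  \<open>super\<close>. Its Laplacian is at least some \<open>p > 0\<close> near \<open>y\<close>,
  uniformly in the smoothing \<open>e\<close>, so this part contributes a fixed positive amount. The
  negative part has bounded mass and concentrates at \<open>c\<close>, where \<open>v\<close> is
  small, so its contribution can be made smaller.\<close>

lemma strong_minimum_principle:
  fixes v :: "real^2 \<Rightarrow> real"
  assumes cv: "continuous_on UNIV v" and R: "0 < R" and v0: "v c = 0"
    and nonneg: "\<And>x. x \<in> cball c R \<Longrightarrow> 0 \<le> v x"
    and super: "\<And>f. test_fun f \<Longrightarrow> (\<And>x. 0 \<le> f x) \<Longrightarrow> (\<And>x. R \<le> dist x c \<Longrightarrow> f x = 0) \<Longrightarrow>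
      (LINT x|lebesgue. v x * laplacian f x) \<le> 0"
    and y: "y \<in> ball c R"
  shows "v y = 0"
proof (rule ccontr)
  assume "v y \<noteq> 0"
  define m where "m = v y / 2"
  define a where "a = dist y c"
  have vy: "0 < v y" using nonneg[of y] y \<open>v y \<noteq> 0\<close> by (simp add: less_le)
  then have m: "0 < m" by (simp add: m_def)
  have a: "0 < a" "a < R"
    using y \<open>v y \<noteq> 0\<close> v0 by (auto simp: a_def dist_commute)
  have cont: "\<exists>d>0. \<forall>x'. dist x' x < d \<longrightarrow> dist (v x') (v x) < \<epsilon>" if "0 < \<epsilon>" for x \<epsilon>
    using cv that unfolding continuous_on_iff by simp
  obtain d' where d': "0 < d'" "\<And>x. dist x y < d' \<Longrightarrow> m \<le> v x"
  proof -
    obtain d' where "0 < d'" and d': "\<And>x. dist x y < d' \<Longrightarrow> dist (v x) (v y) < m"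
      using cont[OF m] by blast
    have "m \<le> v x" if "dist x y < d'" for x
      using d'[OF that] unfolding m_def dist_real_def by linarith
    with \<open>0 < d'\<close> show thesis by (rule that)
  qed
  \<comment> \<open>On \<open>ball y d\<close> one has \<open>m \<le> v\<close>, and the distance to
    \<open>c\<close> stays between \<open>a / 2\<close> and \<open>(R + a) / 2\<close>, hence away
    from both the pole and the cutoff.\<close>
  define d where "d = min d' (min (a / 2) ((R - a) / 2))"
  have "0 < d \<and> d \<le> d' \<and> d \<le> a / 2 \<and> d \<le> (R - a) / 2"
    using d'(1) a by (auto simp: d_def min_def)
  then have d: "0 < d" "d \<le> d'" "d \<le> a / 2" "d \<le> (R - a) / 2" by auto
  define s0 where "s0 = (a / 2)\<^sup>2"
  define s1 where "s1 = ((R + a) / 2)\<^sup>2"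
  have s01: "0 < s0" "s1 < R\<^sup>2" "0 \<le> s1" "s0 \<le> R\<^sup>2"
    using a R unfolding s0_def s1_def by (auto intro!: power_strict_mono power_mono)
  \<comment> \<open>\<open>w0\<close> and \<open>w1\<close> enclose \<open>W\<close> on
    \<open>ball y d\<close> for every \<open>e\<close> up to \<open>1\<close>, so the lower bound
    \<open>p\<close> for the convexity term does not depend on \<open>e\<close>, which is chosen
    last.\<close>
  define w0 where "w0 = ln ((R\<^sup>2 + 1) / (s1 + 1))"
  define w1 where "w1 = ln (R\<^sup>2 / s0)"
  have w0: "0 < w0" using s01 by (simp add: w0_def)
  define p where "p = 4 * s0 / (R\<^sup>2 + 1)\<^sup>2 * (exp (- 1 / w0) / w1 ^ 3)"
  define I where "I = measure lborel (ball y d)"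
  define B where "B = measure lborel (cball c R)"
  have I: "0 < I" using content_ball_pos[OF d(1)] by (simp add: I_def)
  have B: "0 \<le> B" by (simp add: B_def)
  have in_ball: "s0 \<le> (x - c) \<bullet> (x - c)" "(x - c) \<bullet> (x - c) \<le> s1" if "x \<in> ball y d" for x
  proof -
    have "dist y x < d" using that by simp
    then have "a / 2 \<le> norm (x - c)" "norm (x - c) \<le> (R + a) / 2"
      using d(3,4) dist_triangle[of y c x] dist_triangle[of x c y]
      unfolding a_def by (simp_all add: dist_norm norm_minus_commute field_simps)
    then show "s0 \<le> (x - c) \<bullet> (x - c)" "(x - c) \<bullet> (x - c) \<le> s1"
      unfolding s0_def s1_def using a by (simp_all add: power_mono flip: power2_norm_eq_inner)
  qed
  have w01: "w0 \<le> w1"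
    unfolding w0_def w1_def
  proof (rule ln_mono)
    have "s0 \<le> s1" using in_ball[of y] d(1) by simp
    then have "s0 * (R\<^sup>2 + 1) \<le> R\<^sup>2 * (s1 + 1)"
      using s01 mult_mono[of s0 s1 "R\<^sup>2" "R\<^sup>2"] by (simp add: algebra_simps)
    then show "(R\<^sup>2 + 1) / (s1 + 1) \<le> R\<^sup>2 / s0" using s01 by (simp add: divide_simps mult.commute)
  qed (use s01 in \<open>auto intro!: divide_pos_pos add_nonneg_pos\<close>)
  have "0 < w1" using w0 w01 by simp
  then have p: "0 < p" using s01 by (auto simp: p_def intro!: mult_pos_pos divide_pos_pos zero_less_power add_nonneg_pos)
  define M where "M = Sup (v ` cball c R) + 1"
  have M: "v x \<le> M" if "x \<in> cball c R" for x
  proof -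
    have "bdd_above (v ` cball c R)"
      by (intro bounded_imp_bdd_above compact_imp_bounded compact_continuous_image
          continuous_on_subset[OF cv] compact_cball) auto
    then have "v x \<le> Sup (v ` cball c R)" using that by (intro cSup_upper) auto
    then show ?thesis by (simp add: M_def)
  qed
  have "0 < M" using M[of y] vy y by simp
  \<comment> \<open>The gain from \<open>ball y d\<close> is at least \<open>p * m * I\<close>. With
    this \<open>\<eta>\<close> the loss near \<open>c\<close>, at most \<open>4 * \<eta>\<close>
    times the kernel mass, is at most a quarter of it.\<close>
  define \<eta> where "\<eta> = p * m * I / (16 * (64 * pi / 3))"
  have \<eta>: "0 < \<eta>" using p m I by (simp add: \<eta>_def)
  obtain \<sigma> where \<sigma>: "0 < \<sigma>" "\<And>x. dist x c < \<sigma> \<Longrightarrow> v x \<le> \<eta>"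
  proof -
    obtain d' where "0 < d'" and d': "\<And>x. dist x c < d' \<Longrightarrow> dist (v x) (v c) < \<eta>"
      using cont[OF \<eta>] by blast
    have "v x \<le> \<eta>" if "dist x c < d'" for x
      using d'[OF that] unfolding v0 dist_real_def by linarith
    with \<open>0 < d'\<close> show thesis by (rule that)
  qed
  \<comment> \<open>Makes the loss at distance at least \<open>\<sigma>\<close> from
    \<open>c\<close> at most another quarter of \<open>p * m * I\<close>; \<open>B + 1\<close> keeps
    the denominator positive.\<close>
  define e where "e = min 1 (p * m * I * \<sigma> ^ 4 / (16 * M * (B + 1)))"
  have e: "0 < e" "e \<le> 1" using p m I \<sigma> \<open>0 < M\<close> B by (auto simp: e_def intro!: divide_pos_pos mult_pos_pos)
  define W where "W s = ln (R\<^sup>2 + e) - ln (s + e)" for s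
  define f where "f x = hinge (W ((x - c) \<bullet> (x - c)))" for x
  note hl = hinge_log_test_fun[OF e(1) R, where c = c, folded W_def, folded f_def]
  let ?K = "\<lambda>x. e / ((x - c) \<bullet> (x - c) + e)\<^sup>2"
  \<comment> \<open>A pointwise minorant of \<open>v * laplacian f\<close>: the gain near
    \<open>y\<close>, the loss near \<open>c\<close>, and the loss on the rest of the disc.\<close>
  let ?L = "\<lambda>x. p * m * indicator (ball y d) x - 4 * \<eta> * ?K x - 4 * M * e / \<sigma> ^ 4 * indicator (cball c R) x"
  have se: "0 < (x - c) \<bullet> (x - c) + e" for x using e by (simp add: add_nonneg_pos)
  have core: "p \<le> 4 * ((x - c) \<bullet> (x - c)) * flat 3 (W ((x - c) \<bullet> (x - c))) / ((x - c) \<bullet> (x - c) + e)\<^sup>2"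
    if "x \<in> ball y d" for x
  proof -
    define s where "s = (x - c) \<bullet> (x - c)"
    have s: "s0 \<le> s" "s \<le> s1" using in_ball[OF that] by (simp_all add: s_def)
    have W: "W s = ln ((R\<^sup>2 + e) / (s + e))"
      unfolding W_def using s s01 e by (simp add: ln_div add_nonneg_pos)
    \<comment> \<open>Since \<open>s1\<close> is less than \<open>R\<^sup>2\<close>, the quotient
      decreases in \<open>e\<close>, so \<open>e = 1\<close> is the worst case.\<close>
    have "(R\<^sup>2 + 1) / (s1 + 1) \<le> (R\<^sup>2 + e) / (s1 + e)"
    proof -
      have "s1 + e * R\<^sup>2 \<le> e * s1 + R\<^sup>2"
        using mult_nonneg_nonneg[of "R\<^sup>2 - s1" "1 - e"] s01 e by (simp add: algebra_simps)
      then show ?thesis using s01 e by (simp add: divide_simps) (simp add: algebra_simps)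
    qed
    also have "\<dots> \<le> (R\<^sup>2 + e) / (s + e)" using s s01 e by (intro divide_left_mono) auto
    finally have "w0 \<le> W s"
      unfolding w0_def W using s01 by (intro ln_mono) (auto intro!: divide_pos_pos add_nonneg_pos)
    moreover have "W s \<le> w1"
      unfolding w1_def W
    proof (rule ln_mono)
      have "R\<^sup>2 * s0 \<le> R\<^sup>2 * s" "e * s0 \<le> e * R\<^sup>2" using s s01 e by (auto intro: mult_left_mono)
      then have "(R\<^sup>2 + e) * s0 \<le> R\<^sup>2 * (s + e)" by (simp add: algebra_simps)
      then show "(R\<^sup>2 + e) / (s + e) \<le> R\<^sup>2 / s0" using s s01 e by (simp add: divide_simps mult.commute)
    qed (use s s01 e in \<open>auto intro!: divide_pos_pos add_nonneg_pos\<close>)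
    ultimately have Ws: "w0 \<le> W s" "W s \<le> w1" "0 < W s" using w0 by auto
    have "exp (- 1 / w0) / w1 ^ 3 \<le> exp (- 1 / W s) / W s ^ 3"
      using Ws w0 by (intro frac_le power_mono) (auto simp: divide_simps)
    then have 1: "exp (- 1 / w0) / w1 ^ 3 \<le> flat 3 (W s)" using Ws by (simp add: flat_def)
    have "(s + e)\<^sup>2 \<le> (R\<^sup>2 + 1)\<^sup>2" using s s01 e by (intro power_mono) auto
    then have 2: "4 * s0 / (R\<^sup>2 + 1)\<^sup>2 \<le> 4 * s / (s + e)\<^sup>2"
      using s s01 e by (intro frac_le) auto
    have "p \<le> 4 * s / (s + e)\<^sup>2 * flat 3 (W s)"
      unfolding p_def using s s01 \<open>0 < w1\<close> by (intro mult_mono[OF 2 1]) auto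
    then show ?thesis by (simp add: s_def)
  qed
  have lower: "?L x \<le> v x * laplacian f x" for x
  proof (cases "x \<in> cball c R")
    case False
    have "x \<notin> ball y d"
    proof
      assume "x \<in> ball y d"
      then have "dist x c < R" using d(4) a dist_triangle[of x c y]
        unfolding a_def by (simp add: dist_commute field_simps)
      then show False using False by (simp add: dist_commute)
    qed
    moreover have "laplacian f x = 0"
    proof -
      have "R\<^sup>2 \<le> (norm (x - c))\<^sup>2"
        using False R by (intro power_mono) (auto simp: dist_norm norm_minus_commute)
      then have "W ((x - c) \<bullet> (x - c)) \<le> 0"
        using e se[of x] by (simp add: W_def power2_norm_eq_inner add_nonneg_pos)
      then show ?thesis by (simp add: hl(4) flat_def)
    qed
    ultimately show ?thesis using False \<eta> e by simp
  next
    case True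
    define G where "G = flat 0 (W ((x - c) \<bullet> (x - c))) + flat 1 (W ((x - c) \<bullet> (x - c)))"
    define H where "H = 4 * ((x - c) \<bullet> (x - c)) * flat 3 (W ((x - c) \<bullet> (x - c))) / ((x - c) \<bullet> (x - c) + e)\<^sup>2"
    have G: "0 \<le> G" "G \<le> 1" unfolding G_def by (rule hinge_deriv_bounds)+
    have H: "0 \<le> H" by (simp add: H_def flat_nonneg)
    have vx: "0 \<le> v x" "v x \<le> M" using nonneg M True by auto
    have eq: "v x * laplacian f x = v x * H - 4 * (v x * ?K x) * G"
      unfolding hl(4) G_def H_def by (simp add: algebra_simps)
    have K: "0 \<le> ?K x" using e by simp
    have 1: "p * m * indicator (ball y d) x \<le> v x * H"
    proof (cases "x \<in> ball y d")
      case x: True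
      then have "m \<le> v x" using d'(2)[of x] d(2) by (simp add: dist_commute)
      moreover have "p \<le> H" unfolding H_def by (rule core[OF x])
      ultimately show ?thesis using x mult_mono[of p H m "v x"] p m H by (simp add: mult.commute)
    qed (use vx H in simp)
    \<comment> \<open>Within \<open>\<sigma>\<close> of \<open>c\<close> the value of
      \<open>v\<close> is at most \<open>\<eta>\<close>; farther out the kernel itself is at most
      \<open>e / \<sigma> ^ 4\<close>.\<close>
    have 2: "v x * ?K x \<le> \<eta> * ?K x + M * e / \<sigma> ^ 4"
    proof (cases "dist x c < \<sigma>")
      case x: True
      have "v x * ?K x \<le> \<eta> * ?K x" by (intro mult_right_mono \<sigma>(2) x K)
      moreover have "0 \<le> M * e / \<sigma> ^ 4" using \<open>0 < M\<close> e by simp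
      ultimately show ?thesis by linarith
    next
      case False
      have "\<sigma>\<^sup>2 \<le> (norm (x - c))\<^sup>2" using False \<sigma>(1) by (intro power_mono) (auto simp: dist_norm)
      then have "(\<sigma>\<^sup>2)\<^sup>2 \<le> ((x - c) \<bullet> (x - c) + e)\<^sup>2"
        using e by (intro power_mono) (auto simp: power2_norm_eq_inner)
      then have "?K x \<le> e / \<sigma> ^ 4"
        using e se[of x] \<sigma>(1) by (intro divide_left_mono mult_pos_pos zero_less_power) auto
      then have "v x * ?K x \<le> M * (e / \<sigma> ^ 4)" using vx K by (intro mult_mono) auto
      moreover have "0 \<le> \<eta> * ?K x" using K \<eta> by (intro mult_nonneg_nonneg) auto
      ultimately show ?thesis by simp
    qed
    have "4 * (v x * ?K x) * G \<le> 4 * (v x * ?K x) * 1"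
      using vx K G by (intro mult_left_mono mult_nonneg_nonneg) auto
    with 1 2 show ?thesis unfolding eq using True by simp
  qed
  have fin: "emeasure lborel (ball y d) < \<infinity>" "emeasure lborel (cball c R) < \<infinity>"
    by (rule emeasure_bounded_finite, simp)+
  have intL: "integrable lborel ?L"
    by (intro Bochner_Integration.integrable_diff integrable_mult_right integrable_real_indicator
        newton_kernel_mass(1)[OF e(1)] fin) auto
  have cf: "continuous_on UNIV (\<lambda>x. v x * laplacian f x)"
    using hl(1) cv by (auto simp: test_fun_def intro!: continuous_intros continuous_on_laplacian)
  have intv: "integrable lebesgue (\<lambda>x. v x * laplacian f x)"
    by (rule integrable_test_fun(2)[OF hl(1) cv])
  have "integrable lebesgue ?L" using intL by (simp add: integrable_completion)
  then have "(LINT x|lebesgue. ?L x) \<le> (LINT x|lebesgue. v x * laplacian f x)"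
    using intv lower by (intro integral_mono) auto
  also have "\<dots> \<le> 0" by (intro super hl)
  finally have "(LINT x|lborel. ?L x) \<le> 0"
    using intL by (simp add: integral_completion)
  moreover have "(LINT x|lborel. ?L x) = p * m * I - 4 * \<eta> * (LINT x|lborel. ?K x) - 4 * M * e / \<sigma> ^ 4 * B"
  proof -
    have lin: "(LINT x|lborel. a1 * g1 x - a2 * g2 x - a3 * g3 x)
        = a1 * (LINT x|lborel. g1 x) - a2 * (LINT x|lborel. g2 x) - a3 * (LINT x|lborel. g3 x)"
      if "integrable lborel g1" "integrable lborel g2" "integrable lborel g3"
      for a1 a2 a3 :: real and g1 g2 g3 :: "real^2 \<Rightarrow> real"
      using that by simp
    show ?thesis
      unfolding I_def B_def
      by (subst lin[OF integrable_real_indicator newton_kernel_mass(1)[OF e(1)] integrable_real_indicator])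
        (use fin in auto)
  qed
  moreover have "4 * \<eta> * (LINT x|lborel. ?K x) \<le> 4 * \<eta> * (64 * pi / 3)"
    using newton_kernel_mass(2)[OF e(1), of c] \<eta> by (intro mult_left_mono) auto
  moreover have "4 * \<eta> * (64 * pi / 3) = p * m * I / 4" by (simp add: \<eta>_def)
  moreover have "4 * M * e / \<sigma> ^ 4 * B \<le> p * m * I / 4"
  proof -
    have "4 * M * e / \<sigma> ^ 4 * B \<le> 4 * M * e / \<sigma> ^ 4 * (B + 1)"
      using \<open>0 < M\<close> e by (intro mult_left_mono) auto
    also have "\<dots> = e * (4 * M * (B + 1) / \<sigma> ^ 4)" by (simp add: field_simps)
    also have "\<dots> \<le> p * m * I * \<sigma> ^ 4 / (16 * M * (B + 1)) * (4 * M * (B + 1) / \<sigma> ^ 4)"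
      using \<open>0 < M\<close> B by (intro mult_right_mono) (auto simp: e_def)
    also have "\<dots> = p * m * I / 4" using \<open>0 < M\<close> B \<sigma>(1) by (simp add: divide_simps)
    finally show ?thesis .
  qed
  moreover have "0 < p * m * I" using p m I by simp
  ultimately show False by linarith
qed

subsection \<open>Zeros on small circles\<close>

lemma eigenfunction_not_pos_on_sphere:
  fixes V u :: "real^2 \<Rightarrow> real"
  assumes ef: "eigenfunction V lam u" and cV: "continuous_on UNIV V"
    and t: "0 < t" "lam * t\<^sup>2 < 4" "0 < lam" and uz: "u z = 0"
    and V: "\<And>x. x \<in> cball z t \<Longrightarrow> 0 \<le> V x \<and> V x \<le> lam"
  shows "\<exists>x. dist x z = t \<and> u x \<le> 0"
proof (rule ccontr)
  assume "\<not> ?thesis"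
  then have pos: "\<And>x. dist x z = t \<Longrightarrow> 0 < u x" by force
  have cu: "continuous_on UNIV u" using ef by (simp add: eigenfunction_def)
  \<comment> \<open>The coefficient gives \<open>w\<close> the Laplacian \<open>- lam\<close>, and
    \<open>lam * t\<^sup>2 < 4\<close> keeps \<open>w\<close> positive on the disc.\<close>
  define w where "w x = 1 + (- (lam / 4)) * ((x - z) \<bullet> (x - z))" for x
  have cw: "continuous_on UNIV w" unfolding w_def by (intro continuous_intros)
  have w: "0 < w x" "w x \<le> 1" if "x \<in> cball z t" for x
  proof -
    have "norm (x - z) \<le> t" using that by (simp add: dist_norm norm_minus_commute)
    then have "(x - z) \<bullet> (x - z) \<le> t\<^sup>2"
      unfolding power2_norm_eq_inner[symmetric] by (intro power_mono) auto
    then have "lam * ((x - z) \<bullet> (x - z)) < 4"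
      using mult_left_mono[of _ "t\<^sup>2" lam] t by (meson le_less_trans less_imp_le)
    then show "0 < w x" by (simp add: w_def)
    show "w x \<le> 1" using t by (simp add: w_def)
  qed
  have "continuous_on (cball z t) (\<lambda>x. u x / w x)"
    using w by (intro continuous_on_divide continuous_on_subset[OF cu] continuous_on_subset[OF cw]) force+
  then obtain x1 where x1: "x1 \<in> cball z t" "\<And>x. x \<in> cball z t \<Longrightarrow> u x1 / w x1 \<le> u x / w x"
    using continuous_attains_inf[of "cball z t" "\<lambda>x. u x / w x"] t by auto
  define m where "m = u x1 / w x1"
  define v where "v x = u x - m * w x" for x
  have m: "m \<le> 0" using x1(2)[of z] t uz by (simp add: m_def)
  have cv: "continuous_on UNIV v" unfolding v_def by (intro continuous_intros cu cw)
  have v0: "0 \<le> v x" if "x \<in> cball z t" for x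
    using x1(2)[OF that] w[OF that] by (simp add: v_def m_def pos_le_divide_eq)
  have vpos: "0 < v x" if "dist x z = t" for x
  proof -
    have "m * w x \<le> 0" using m w[of x] that by (simp add: mult_nonpos_nonneg dist_commute)
    then show ?thesis using pos[OF that] by (simp add: v_def)
  qed
  define Z where "Z = cball z t \<inter> v -` {0}"
  have "v x1 = 0" using w[OF x1(1)] by (simp add: v_def m_def)
  then have "Z \<noteq> {}" using x1(1) by (auto simp: Z_def)
  have "compact Z"
    unfolding Z_def using cv by (intro compact_Int_closed compact_cball closed_vimage) auto
  moreover have "continuous_on Z (\<lambda>x. x $ 1)" by (intro continuous_intros)
  \<comment> \<open>Choosing a zero of \<open>v\<close> with the largest first coordinate replaces a
    connectedness argument: the minimum principle at \<open>x0\<close> produces the zero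
    \<open>y\<close>, which lies strictly further to the right.\<close>
  ultimately obtain x0 where x0: "x0 \<in> Z" "\<And>x. x \<in> Z \<Longrightarrow> x $ 1 \<le> x0 $ 1"
    using continuous_attains_sup[of Z "\<lambda>x. x $ 1"] \<open>Z \<noteq> {}\<close> by blast
  define R where "R = (t - dist x0 z) / 2"
  have "dist x0 z \<noteq> t" using vpos[of x0] x0(1) by (auto simp: Z_def)
  then have R: "0 < R" using x0(1) by (simp add: R_def Z_def dist_commute)
  have sub: "cball x0 R \<subseteq> cball z t"
  proof
    fix x assume "x \<in> cball x0 R"
    then show "x \<in> cball z t" using dist_triangle[of z x x0] R by (simp add: R_def dist_commute)
  qed
  define y where "y = x0 + (R / 2) *\<^sub>R axis 1 1"
  have "v y = 0"
  proof (rule strong_minimum_principle[OF cv R])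
    show "v x0 = 0" using x0(1) by (simp add: Z_def)
    show "0 \<le> v x" if "x \<in> cball x0 R" for x using v0 that sub by auto
    show "y \<in> ball x0 R" using R by (simp add: y_def dist_norm)
    fix f :: "real^2 \<Rightarrow> real"
    assume f: "test_fun f" "\<And>x. 0 \<le> f x" "\<And>x. R \<le> dist x x0 \<Longrightarrow> f x = 0"
    have "(LINT x|lebesgue. v x * laplacian f x)
        = (LINT x|lebesgue. u x * laplacian f x - m * (w x * laplacian f x))"
      by (simp add: v_def algebra_simps)
    also have "\<dots> = (LINT x|lebesgue. u x * laplacian f x) - m * (LINT x|lebesgue. w x * laplacian f x)"
      using integrable_test_fun(2)[OF f(1) cu] integrable_test_fun(2)[OF f(1) cw] by simp
    also have "\<dots> = (LINT x|lebesgue. ((V x - lam) * u x) * f x) + (m * lam) * (LINT x|lebesgue. f x)"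
      unfolding eigenfunction_weak[OF ef cV f(1)] w_def integral_quadratic_laplacian[OF f(1)] by simp
    also have "\<dots> = (LINT x|lebesgue. ((V x - lam) * u x) * f x + (m * lam) * f x)"
    proof -
      have "integrable lebesgue (\<lambda>x. ((V x - lam) * u x) * f x)" "integrable lebesgue (\<lambda>x. (m * lam) * f x)"
        by (intro integrable_test_fun f continuous_intros cu cV)+
      then show ?thesis by simp
    qed
    also have "\<dots> \<le> 0"
    proof -
      have nonpos: "((V x - lam) * u x) * f x + (m * lam) * f x \<le> 0" for x
      proof (cases "x \<in> cball x0 R")
        case True
        then have x: "x \<in> cball z t" using sub by auto
        \<comment> \<open>Substituting \<open>u = v + m * w\<close> turns the factor of
          \<open>f x\<close> into \<open>(V - lam) * v + m * (V * w + lam * (1 - w))\<close>. Both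
          summands are nonpositive because \<open>V\<close> lies between \<open>0\<close> and
          \<open>lam\<close>, \<open>w\<close> between \<open>0\<close> and \<open>1\<close>, and
          \<open>m \<le> 0\<close>.\<close>
        have "(V x - lam) * v x \<le> 0" using V[OF x] v0[OF x] by (simp add: mult_nonpos_nonneg)
        moreover have "m * (V x * w x + lam * (1 - w x)) \<le> 0"
          using V[OF x] w[OF x] t m by (intro mult_nonpos_nonneg add_nonneg_nonneg mult_nonneg_nonneg) auto
        ultimately have "(V x - lam) * v x + m * (V x * w x + lam * (1 - w x)) \<le> 0" by simp
        then have "(V x - lam) * u x + m * lam \<le> 0" by (simp add: v_def algebra_simps)
        then have "((V x - lam) * u x + m * lam) * f x \<le> 0" using f(2) by (simp add: mult_nonpos_nonneg)
        then show ?thesis by (simp add: algebra_simps)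
      next
        case False
        then show ?thesis using f(3)[of x] by (simp add: dist_commute)
      qed
      have "0 \<le> (LINT x|lebesgue. - (((V x - lam) * u x) * f x + (m * lam) * f x))"
        by (intro integral_nonneg_AE AE_I2) (use nonpos in \<open>simp only: neg_0_le_iff_le simp_thms\<close>)
      then show ?thesis unfolding Bochner_Integration.integral_minus by simp
    qed
    finally show "(LINT x|lebesgue. v x * laplacian f x) \<le> 0" .
  qed
  moreover have "y \<in> cball x0 R" using R by (simp add: y_def dist_norm)
  ultimately have "y \<in> Z" using sub by (auto simp: Z_def)
  from x0(2)[OF this] show False using R by (simp add: y_def)
qed

text \<open>The preceding lemma for \<open>u\<close> and for \<open>- u\<close> excludes a strict
  sign on the circle, which is connected in the plane.\<close>

lemma eigenfunction_zero_on_sphere: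
  fixes V u :: "real^2 \<Rightarrow> real"
  assumes "eigenfunction V lam u" "continuous_on UNIV V" "0 < t" "lam * t\<^sup>2 < 4" "0 < lam" "u z = 0"
    and "\<And>x. x \<in> cball z t \<Longrightarrow> 0 \<le> V x \<and> V x \<le> lam"
  shows "\<exists>x. dist x z = t \<and> u x = 0"
proof (rule ccontr)
  assume no: "\<not> ?thesis"
  have uz: "- u z = 0" using assms(6) by simp
  have "connected (sphere z t)" by (rule connected_sphere) simp
  moreover have "continuous_on (sphere z t) u"
    using assms(1) continuous_on_subset unfolding eigenfunction_def by blast
  ultimately have "(\<forall>x\<in>sphere z t. 0 < u x) \<or> (\<forall>x\<in>sphere z t. u x < 0)"
    using no by (intro connected_nonzero_sign) (auto simp: dist_commute)
  moreover obtain x where "x \<in> sphere z t" "u x \<le> 0"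
    using eigenfunction_not_pos_on_sphere[OF assms] by (auto simp: dist_commute)
  moreover obtain y where "y \<in> sphere z t" "0 \<le> u y"
    using eigenfunction_not_pos_on_sphere[OF eigenfunction_uminus[OF assms(1)] assms(2-5) uz assms(7)]
    by (auto simp: dist_commute)
  ultimately show False by (meson not_le)
qed

subsection \<open>Lower bounds for the length\<close>

text \<open>The image lies between its infimum and supremum, which differ by at most the diameter.
  The enclosing interval serves as \<open>B\<close> because the image itself may fail to be
  measurable.\<close>

lemma emeasure_image_lipschitz_le:
  fixes g :: "'a::metric_space \<Rightarrow> real"
  assumes "\<And>x y. \<bar>g x - g y\<bar> \<le> dist x y" "bounded A"
  shows "\<exists>B\<in>sets lborel. g ` A \<subseteq> B \<and> emeasure lborel B \<le> ennreal (diameter A)"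
proof (cases "A = {}")
  case False
  have diff: "\<bar>g x - g y\<bar> \<le> diameter A" if "x \<in> A" "y \<in> A" for x y
    using assms(1)[of x y] diameter_bounded_bound[OF assms(2) that] by linarith
  obtain a where a: "a \<in> A" using False by auto
  have ge: "g a - diameter A \<le> g x" and le: "g x \<le> g a + diameter A" if "x \<in> A" for x
    using diff[OF a that] by auto
  have "bdd_below (g ` A)" "bdd_above (g ` A)" using ge le by (auto intro!: bdd_belowI bdd_aboveI)
  then have sub: "g ` A \<subseteq> {Inf (g ` A)..Sup (g ` A)}"
    using cInf_lower[of _ "g ` A"] cSup_upper[of _ "g ` A"] by (simp add: subset_iff)
  have "Sup (g ` A) \<le> Inf (g ` A) + diameter A"
  proof (rule cSup_least)
    fix r assume "r \<in> g ` A"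
    then obtain x where x: "x \<in> A" "r = g x" by auto
    have "r - diameter A \<le> s" if "s \<in> g ` A" for s
      using that diff[OF x(1)] x(2) by (auto simp: abs_le_iff algebra_simps)
    then have "r - diameter A \<le> Inf (g ` A)" using False by (intro cInf_greatest) auto
    then show "r \<le> Inf (g ` A) + diameter A" by simp
  qed (use False in simp)
  moreover have "Inf (g ` A) \<le> Sup (g ` A)" using sub a by fastforce
  ultimately have "emeasure lborel {Inf (g ` A)..Sup (g ` A)} \<le> ennreal (diameter A)"
    by (simp add: ennreal_leI)
  with sub show ?thesis by (intro bexI[of _ "{Inf (g ` A)..Sup (g ` A)}"]) auto
qed (auto intro!: bexI[of _ "{}"])

text \<open>Projecting a cover by the 1-Lipschitz map \<open>g\<close> reduces the bound to
  countable subadditivity of Lebesgue measure on the line.\<close>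

lemma length_le_sum_diameter:
  fixes g :: "'a::metric_space \<Rightarrow> real" and C :: "nat \<Rightarrow> 'a set"
  assumes "\<And>x y. \<bar>g x - g y\<bar> \<le> dist x y" "\<And>i. bounded (C i)" "{0<..<T} \<subseteq> g ` (\<Union>i. C i)"
  shows "ennreal T \<le> (\<Sum>i. ennreal (diameter (C i)))"
proof -
  obtain B where B: "\<And>i. B i \<in> sets lborel" "\<And>i. g ` C i \<subseteq> B i"
      "\<And>i. emeasure lborel (B i) \<le> ennreal (diameter (C i))"
    using emeasure_image_lipschitz_le[OF assms(1) assms(2)] by metis
  have "{0<..<T} \<subseteq> (\<Union>i. g ` C i)" using assms(3) by (simp add: image_UN)
  also have "\<dots> \<subseteq> (\<Union>i. B i)" using B(2) by (intro UN_mono) simp_all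
  finally have cover: "{0<..<T} \<subseteq> (\<Union>i. B i)" .
  have meas: "(\<Union>i. B i) \<in> sets lborel" using B(1) by (intro sets.countable_UN) auto
  have "ennreal T = emeasure lborel {0<..<T}" by (cases "0 \<le> T") (auto simp: ennreal_neg)
  also have "\<dots> \<le> emeasure lborel (\<Union>i. B i)"
    by (rule emeasure_mono[OF cover meas])
  also have "\<dots> \<le> (\<Sum>i. emeasure lborel (B i))"
    using B(1) by (intro emeasure_subadditive_countably) auto
  also have "\<dots> \<le> (\<Sum>i. ennreal (diameter (C i)))"
    by (intro suminf_le B summableI)
  finally show ?thesis .
qed

text \<open>A covering set of diameter smaller than the separation meets at most one of the
  pieces, so its diameter is charged only once.\<close>

lemma hausdorff_length_ge_separated:
  fixes S :: "'a::metric_space set" and P :: "'j \<Rightarrow> 'a set" and g :: "'j \<Rightarrow> 'a \<Rightarrow> real"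
  assumes "finite J" "0 < sep"
    and P: "\<And>j. j \<in> J \<Longrightarrow> P j \<subseteq> S"
    and g: "\<And>j x y. j \<in> J \<Longrightarrow> \<bar>g j x - g j y\<bar> \<le> dist x y"
    and T: "\<And>j. j \<in> J \<Longrightarrow> {0<..<T} \<subseteq> g j ` P j"
    and sep: "\<And>j k x y. j \<in> J \<Longrightarrow> k \<in> J \<Longrightarrow> j \<noteq> k \<Longrightarrow> x \<in> P j \<Longrightarrow> y \<in> P k \<Longrightarrow> sep < dist x y"
  shows "of_nat (card J) * ennreal T \<le> hausdorff_length S"
proof -
  have "of_nat (card J) * ennreal T \<le> (\<Sum>i. ennreal (diameter (C i)))"
    if C: "S \<subseteq> (\<Union>i. C i)" "\<And>i. bounded (C i)" "\<And>i. diameter (C i) \<le> sep" for C :: "nat \<Rightarrow> 'a set"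
  proof -
    have bd: "bounded (C i \<inter> P j)" for i j using C(2)[of i] by (rule bounded_subset) auto
    have one: "(\<Sum>j\<in>J. ennreal (diameter (C i \<inter> P j))) \<le> ennreal (diameter (C i))" for i
    proof (cases "\<exists>j\<in>J. C i \<inter> P j \<noteq> {}")
      case False
      then have "(\<Sum>j\<in>J. ennreal (diameter (C i \<inter> P j))) = 0" by (intro sum.neutral) auto
      then show ?thesis by simp
    next
      case True
      then obtain j x where j: "j \<in> J" "x \<in> C i" "x \<in> P j" by auto
      have "C i \<inter> P k = {}" if "k \<in> J - {j}" for k
      proof (rule ccontr)
        assume "C i \<inter> P k \<noteq> {}"
        then obtain y where "y \<in> C i" "y \<in> P k" by auto
        then show False
          using sep[of j k x y] j that diameter_bounded_bound[OF C(2) j(2), of y] C(3)[of i] by auto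
      qed
      then have "(\<Sum>k\<in>J. ennreal (diameter (C i \<inter> P k))) = ennreal (diameter (C i \<inter> P j))"
        using assms(1) j(1) by (subst sum.remove[of J j]) auto
      also have "\<dots> \<le> ennreal (diameter (C i))"
        using C(2)[of i] by (intro ennreal_leI diameter_subset) auto
      finally show ?thesis .
    qed
    have "of_nat (card J) * ennreal T = (\<Sum>j\<in>J. ennreal T)" by simp
    also have "\<dots> \<le> (\<Sum>j\<in>J. \<Sum>i. ennreal (diameter (C i \<inter> P j)))"
    proof (rule sum_mono)
      fix j assume j: "j \<in> J"
      have "P j \<subseteq> (\<Union>i. C i \<inter> P j)" using P[OF j] C(1) by auto
      then have "{0<..<T} \<subseteq> g j ` (\<Union>i. C i \<inter> P j)" using T[OF j] by (meson image_mono subset_trans)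
      then show "ennreal T \<le> (\<Sum>i. ennreal (diameter (C i \<inter> P j)))"
        using g[OF j] bd by (intro length_le_sum_diameter) auto
    qed
    also have "\<dots> = (\<Sum>i. \<Sum>j\<in>J. ennreal (diameter (C i \<inter> P j)))"
      by (rule suminf_sum[symmetric]) (rule summableI)
    also have "\<dots> \<le> (\<Sum>i. ennreal (diameter (C i)))"
      by (intro suminf_le one summableI)
    finally show ?thesis .
  qed
  then have "of_nat (card J) * ennreal T \<le>
      (INF C\<in>{C :: nat \<Rightarrow> 'a set. S \<subseteq> (\<Union>i. C i) \<and> (\<forall>i. bounded (C i) \<and> diameter (C i) \<le> sep)}.
        \<Sum>i. ennreal (diameter (C i)))"
    by (intro INF_greatest) auto
  also have "\<dots> \<le> hausdorff_length S"
    unfolding hausdorff_length_def using assms(2) by (intro SUP_upper) auto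
  finally show ?thesis .
qed

subsection \<open>The first zero of the Bessel function\<close>

lemma bessel_J0_terms:
  "bessel_J0 x = (\<Sum>m. (-1) ^ m * ((x\<^sup>2 / 4) ^ m / (fact m)\<^sup>2))"
  unfolding bessel_J0_def by (intro suminf_cong) (simp add: power_mult power_divide power2_eq_square)

lemma summable_bessel: "summable (\<lambda>m. y ^ m / (fact m)\<^sup>2 :: real)"
proof (rule summable_comparison_test')
  show "summable (\<lambda>m. inverse (fact m) * \<bar>y\<bar> ^ m)" by (rule summable_exp)
  show "norm (y ^ m / (fact m)\<^sup>2) \<le> inverse (fact m) * \<bar>y\<bar> ^ m" if "0 \<le> m" for m
  proof -
    have "\<bar>y\<bar> ^ m / (fact m)\<^sup>2 \<le> \<bar>y\<bar> ^ m / fact m"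
      using fact_ge_1[of m, where 'a = real] by (intro divide_left_mono) (auto simp: power2_eq_square)
    then show ?thesis by (simp add: power_abs abs_mult divide_inverse mult.commute)
  qed
qed

lemma continuous_on_bessel_J0: "continuous_on S bessel_J0"
proof -
  define c :: "nat \<Rightarrow> real" where "c m = (-1) ^ m / (fact m)\<^sup>2" for m
  have eq: "bessel_J0 x = (\<Sum>m. c m * (x\<^sup>2 / 4) ^ m)" for x
    unfolding bessel_J0_terms c_def by (intro suminf_cong) simp
  have "summable (\<lambda>m. c m * y ^ m)" for y
    by (rule summable_norm_cancel)
      (use summable_bessel[of "\<bar>y\<bar>"] in \<open>simp add: c_def power_abs abs_mult\<close>)
  then have "isCont (\<lambda>y. \<Sum>m. c m * y ^ m) y" for y
    using isCont_powser[of c "\<bar>y\<bar> + 1" y] by simp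
  then have "continuous_on UNIV (\<lambda>y. \<Sum>m. c m * y ^ m)" by (simp add: continuous_at_imp_continuous_on)
  then have "continuous_on S (\<lambda>x. \<Sum>m. c m * (x\<^sup>2 / 4) ^ m)"
    by (rule continuous_on_compose2) (auto intro!: continuous_intros)
  then show ?thesis by (simp add: eq[abs_def])
qed

lemma bessel_term_decreasing:
  assumes "0 \<le> y" "y \<le> real (Suc m) ^ 2"
  shows "y ^ Suc m / (fact (Suc m))\<^sup>2 \<le> y ^ m / (fact m)\<^sup>2"
proof -
  have "y ^ Suc m / (fact (Suc m))\<^sup>2 = (y ^ m / (fact m)\<^sup>2) * (y / real (Suc m) ^ 2)"
    by (simp add: power_mult_distrib mult_ac)
  also have "\<dots> \<le> (y ^ m / (fact m)\<^sup>2) * 1"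
    using assms by (intro mult_left_mono) (auto simp: divide_simps)
  finally show ?thesis by simp
qed

text \<open>In \<open>y = x\<^sup>2 / 4\<close> the series alternates with decreasing terms for
  \<open>y < 1\<close>, so it is bounded below by its first two terms \<open>1 - y\<close>.\<close>

lemma bessel_J0_pos:
  assumes "0 < x" "x < 2"
  shows "0 < bessel_J0 x"
proof -
  define y where "y = x\<^sup>2 / 4"
  have y: "0 \<le> y" "y < 1"
    using assms power_strict_mono[of x 2 2] by (auto simp: y_def)
  let ?a = "\<lambda>m. y ^ m / (fact m)\<^sup>2"
  have "(\<Sum>i<2*1. (-1)^i * ?a i) \<le> (\<Sum>i. (-1)^i * ?a i)"
  proof (rule summable_Leibniz'(2))
    show "?a \<longlonglongrightarrow> 0" by (rule summable_LIMSEQ_zero[OF summable_bessel])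
    show "0 \<le> ?a n" for n using y by simp
    show "?a (Suc n) \<le> ?a n" for n
    proof (rule bessel_term_decreasing[OF y(1)])
      have "1 \<le> real (Suc n) ^ 2" by (rule one_le_power) simp
      then show "y \<le> real (Suc n) ^ 2" using y(2) by linarith
    qed
  qed
  moreover have "(\<Sum>i<2*1. (-1)^i * ?a i) = 1 - y" by (simp add: numeral_2_eq_2)
  ultimately show ?thesis using y unfolding bessel_J0_terms y_def by simp
qed

text \<open>The point is chosen so that \<open>y = 2\<close>. The moduli
  \<open>1, 2, 1, 2/9, 1/36, ...\<close> decrease only from the second on, so the alternating bound
  is applied to the tail, which exceeds \<open>1\<close>. This provides a sign change and hence a
  positive zero.\<close>

lemma bessel_J0_neg: "bessel_J0 (2 * sqrt 2) < 0"
proof -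
  define a :: "nat \<Rightarrow> real" where "a m = 2 ^ m / (fact m)\<^sup>2" for m
  have y: "(2 * sqrt 2)\<^sup>2 / 4 = (2::real)" by (simp add: power_mult_distrib)
  have sm: "summable (\<lambda>m. (-1) ^ m * a m)"
    by (rule summable_norm_cancel) (use summable_bessel[of 2] in \<open>simp add: a_def abs_mult\<close>)
  have sm': "summable (\<lambda>m. (-1) ^ m * a (Suc m))"
    by (rule summable_norm_cancel)
      (use summable_ignore_initial_segment[OF summable_bessel[of 2], of 1] in \<open>simp add: a_def abs_mult\<close>)
  have "bessel_J0 (2 * sqrt 2) = (\<Sum>m. (-1) ^ m * a m)"
    unfolding bessel_J0_terms y a_def ..
  also have "\<dots> = a 0 + (\<Sum>m. (-1) ^ Suc m * a (Suc m))"
    using suminf_split_head[OF sm] by simp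
  also have "\<dots> = 1 - (\<Sum>m. (-1) ^ m * a (Suc m))"
    using suminf_minus[OF sm'] by (simp add: a_def)
  also have "\<dots> < 0"
  proof -
    have "(\<Sum>i<2*2. (-1)^i * a (Suc i)) \<le> (\<Sum>i. (-1)^i * a (Suc i))"
    proof (rule summable_Leibniz'(2))
      show "(\<lambda>m. a (Suc m)) \<longlonglongrightarrow> 0"
        unfolding a_def using summable_LIMSEQ_zero[OF summable_bessel[of 2]] by (rule LIMSEQ_Suc)
      show "0 \<le> a (Suc n)" for n by (simp add: a_def)
      show "a (Suc (Suc n)) \<le> a (Suc n)" for n
        unfolding a_def
      proof (rule bessel_term_decreasing)
        have "2 ^ 2 \<le> real (Suc (Suc n)) ^ 2" by (rule power_mono) auto
        then show "2 \<le> real (Suc (Suc n)) ^ 2" by simp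
      qed simp
    qed
    moreover have "(\<Sum>i<2*2. (-1)^i * a (Suc i)) = 2 - 1 + 2 / 9 - 1 / 36"
      by (simp add: a_def eval_nat_numeral)
    ultimately show ?thesis by simp
  qed
  finally show ?thesis .
qed

text \<open>\<open>LEAST\<close> on the reals has its intended value only if the minimum is
  attained. As there are no zeros in the open interval from \<open>0\<close> to \<open>2\<close>,
  the positive zeros form a closed set, nonempty by the intermediate value theorem, which contains
  its infimum.\<close>

lemma j01_ge_2: "2 \<le> j01"
proof -
  define Z where "Z = {x. 2 \<le> x \<and> bessel_J0 x = 0}"
  have Z: "Z = {x. 0 < x \<and> bessel_J0 x = 0}"
    using bessel_J0_pos by (force simp: Z_def)
  have "2 * 1 \<le> 2 * sqrt (2::real)" by (intro mult_left_mono) auto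
  \<comment> \<open>A negative value at \<open>2\<close> would force a zero between \<open>1\<close>
    and \<open>2\<close>, where the function is positive.\<close>
  moreover have "0 \<le> bessel_J0 2"
  proof (rule ccontr)
    assume "\<not> ?thesis"
    moreover have "0 \<le> bessel_J0 1" using bessel_J0_pos[of 1] by simp
    ultimately obtain x where "1 \<le> x" "x \<le> 2" "bessel_J0 x = 0"
      using IVT2'[of bessel_J0 2 0 1] continuous_on_bessel_J0 by auto
    then show False using bessel_J0_pos[of x] \<open>\<not> 0 \<le> bessel_J0 2\<close> by (cases "x = 2") auto
  qed
  ultimately obtain x where "2 \<le> x" "bessel_J0 x = 0"
    using IVT2'[of bessel_J0 "2 * sqrt 2" 0 2] continuous_on_bessel_J0 bessel_J0_neg by auto
  then have ne: "Z \<noteq> {}" by (auto simp: Z_def)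
  have bdd: "bdd_below Z" by (auto simp: Z_def intro: bdd_belowI)
  have "closed Z"
    unfolding Z_def by (intro closed_Collect_conj closed_Collect_le closed_Collect_eq
        continuous_on_bessel_J0 continuous_on_const continuous_on_id)
  then have "Inf Z \<in> Z" by (rule closed_contains_Inf[OF ne bdd])
  then have "j01 = Inf Z"
    unfolding j01_def using cInf_lower[OF _ bdd] unfolding Z by (intro Least_equality) auto
  with \<open>Inf Z \<in> Z\<close> show ?thesis by (simp add: Z_def)
qed

subsection \<open>Counting cells\<close>

definition cell_index :: "real \<Rightarrow> real^2 \<Rightarrow> int \<times> int" where
  "cell_index s x = (\<lfloor>x $ 1 / s\<rfloor>, \<lfloor>x $ 2 / s\<rfloor>)"

definition cell_centre :: "real \<Rightarrow> int \<times> int \<Rightarrow> real^2" where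
  "cell_centre s j = vector [s * (of_int (fst j) + 1 / 2), s * (of_int (snd j) + 1 / 2)]"

lemma cell_centre_nth [simp]:
  "cell_centre s j $ 1 = s * (of_int (fst j) + 1 / 2)" "cell_centre s j $ 2 = s * (of_int (snd j) + 1 / 2)"
  by (simp_all add: cell_centre_def)

lemma abs_diff_cell_centre:
  assumes "0 < s"
  shows "\<bar>x $ i - cell_centre s (cell_index s x) $ i\<bar> \<le> s / 2"
proof -
  have fl: "\<bar>y - s * (of_int \<lfloor>y / s\<rfloor> + 1 / 2)\<bar> \<le> s / 2" for y
  proof -
    have "of_int \<lfloor>y / s\<rfloor> \<le> y / s" "y / s \<le> of_int \<lfloor>y / s\<rfloor> + 1" by linarith+
    then have "of_int \<lfloor>y / s\<rfloor> * s \<le> y" "y \<le> (of_int \<lfloor>y / s\<rfloor> + 1) * s"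
      by (simp_all only: pos_le_divide_eq[OF assms] pos_divide_le_eq[OF assms])
    then show ?thesis unfolding abs_le_iff by (simp add: algebra_simps)
  qed
  have "i = 1 \<or> i = 2" using exhaust_2 by blast
  then show ?thesis using fl by (auto simp: cell_index_def)
qed

lemma norm_le_vec2: "norm (x :: real^2) \<le> \<bar>x $ 1\<bar> + \<bar>x $ 2\<bar>"
  using norm_le_l1_cart[of x] by (simp add: sum_2)

lemma dist_cell_centre_ge:
  assumes "0 < s" "j \<noteq> k"
  shows "s \<le> dist (cell_centre s j) (cell_centre s k)"
proof -
  have int: "s \<le> \<bar>s * (of_int m + 1 / 2) - s * (of_int n + 1 / 2)\<bar>" if "m \<noteq> n" for m n :: int
  proof -
    have "1 \<le> \<bar>m - n\<bar>" using that by simp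
    then have "(1::real) \<le> \<bar>of_int m - of_int n\<bar>" by linarith
    then have "s * 1 \<le> s * \<bar>of_int m - of_int n\<bar>" using assms(1) by (intro mult_left_mono) auto
    also have "\<dots> = \<bar>s * (of_int m - of_int n)\<bar>" using assms(1) by (simp add: abs_mult)
    finally show ?thesis by (simp add: algebra_simps)
  qed
  have "\<exists>i. s \<le> \<bar>(cell_centre s j - cell_centre s k) $ i\<bar>"
  proof (cases "fst j = fst k")
    case True
    then have "snd j \<noteq> snd k" using assms(2) by (simp add: prod_eq_iff)
    then show ?thesis using int by (intro exI[of _ 2]) simp
  qed (use int in \<open>intro exI[of _ 1], simp\<close>)
  then show ?thesis unfolding dist_norm using component_le_norm_cart order_trans by blast
qed

lemma finite_cell_index:
  assumes "0 < s" "bounded A"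
  shows "finite (cell_index s ` A)"
proof -
  obtain b where b: "\<And>x. x \<in> A \<Longrightarrow> norm x \<le> b" using assms(2) unfolding bounded_iff by auto
  have "cell_index s ` A \<subseteq> {\<lfloor>- b / s\<rfloor>..\<lfloor>b / s\<rfloor>} \<times> {\<lfloor>- b / s\<rfloor>..\<lfloor>b / s\<rfloor>}"
  proof
    fix p assume "p \<in> cell_index s ` A"
    then obtain x where x: "x \<in> A" "p = cell_index s x" by auto
    have "- b \<le> x $ i" "x $ i \<le> b" for i
      using component_le_norm_cart[of x i] b[OF x(1)] by linarith+
    then have "- b / s \<le> x $ i / s" "x $ i / s \<le> b / s" for i
      using assms(1) by (intro divide_right_mono; simp)+
    then show "p \<in> {\<lfloor>- b / s\<rfloor>..\<lfloor>b / s\<rfloor>} \<times> {\<lfloor>- b / s\<rfloor>..\<lfloor>b / s\<rfloor>}"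
      by (simp add: x(2) cell_index_def floor_mono)
  qed
  then show ?thesis by (rule finite_subset) simp
qed

lemma emeasure_le_cells:
  assumes "0 < s" "finite (cell_index s ` A)"
  shows "emeasure lebesgue A \<le> of_nat (card (cell_index s ` A)) * ennreal (s\<^sup>2)"
proof -
  define Q where "Q j = cbox (\<chi> i. cell_centre s j $ i - s / 2) (\<chi> i. cell_centre s j $ i + s / 2)" for j
  have Q: "emeasure lebesgue (Q j) = ennreal (s\<^sup>2)" for j
  proof -
    have "measure lborel (Q j) = s\<^sup>2"
      unfolding Q_def using assms(1)
      by (subst content_cbox_cart) (auto simp: prod_2 power2_eq_square interval_ne_empty_cart field_simps)
    moreover have "emeasure lborel (Q j) = ennreal (measure lborel (Q j))"
      unfolding Q_def using emeasure_lborel_cbox_finite by (intro emeasure_eq_ennreal_measure) (auto simp: less_top)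
    ultimately show ?thesis by (simp add: Q_def)
  qed
  have "A \<subseteq> (\<Union>j\<in>cell_index s ` A. Q j)"
  proof
    fix x assume x: "x \<in> A"
    have "cell_centre s (cell_index s x) $ i - s / 2 \<le> x $ i"
        "x $ i \<le> cell_centre s (cell_index s x) $ i + s / 2" for i
      using abs_diff_cell_centre[OF assms(1), of x i] by linarith+
    then have "x \<in> Q (cell_index s x)" by (simp add: Q_def mem_box_cart)
    then show "x \<in> (\<Union>j\<in>cell_index s ` A. Q j)" using x by blast
  qed
  then have "emeasure lebesgue A \<le> emeasure lebesgue (\<Union>j\<in>cell_index s ` A. Q j)"
    by (rule emeasure_mono) (intro sets.finite_UN assms(2), simp add: Q_def)
  also have "\<dots> \<le> (\<Sum>j\<in>cell_index s ` A. emeasure lebesgue (Q j))"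
    by (intro emeasure_subadditive_finite assms(2) image_subsetI) (simp add: Q_def)
  finally show ?thesis by (simp add: Q)
qed

section \<open>Assembling the lower bound for the nodal length\<close>

lemma nodal_length_ge:
  fixes V u :: "real^2 \<Rightarrow> real"
  assumes V: "\<And>x. 0 < V x" "continuous_on UNIV V"
    and bd: "bounded (B_V V (\<delta> * lam))"
    and par: "0 < \<delta>" "\<delta> < 1" "0 < lam"
    and h: "0 < h" "(1 - \<delta>) * lam * h\<^sup>2 = 1" "25 * h < \<rho>"
    and ef: "eigenfunction V lam u"
  shows "ennreal (2 / sqrt lam / (25 / 2 * h)\<^sup>2) * emeasure lebesgue (B_V_inner V \<rho> (\<delta> * lam))
    \<le> hausdorff_length (nodal_set u \<inter> B_V V (\<delta> * lam))"
proof -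
  \<comment> \<open>In units of \<open>h\<close>: each cell centre has a zero within
    \<open>4 * h\<close>, and the circles around that zero have radius below \<open>T\<close>, at
    most \<open>2 * h\<close>. Everything found for one cell thus lies within \<open>6 * h\<close>
    of its centre. Centres are at least \<open>25 / 2 * h\<close> apart, which leaves the gap
    \<open>h / 2\<close> between pieces.\<close>
  define s where "s = 25 / 2 * h"
  define T where "T = 2 / sqrt lam"
  define A where "A = B_V_inner V \<rho> (\<delta> * lam)"
  define J where "J = cell_index s ` A"
  have s: "0 < s" using h by (simp add: s_def)
  have T0: "0 < T" using par by (simp add: T_def)
  have "lam * T\<^sup>2 = 4" using par by (simp add: T_def power_divide)
  have "T \<le> 2 * h"
  proof (rule power2_le_imp_le)
    have "lam * T\<^sup>2 = 4 * ((1 - \<delta>) * lam * h\<^sup>2)" using \<open>lam * T\<^sup>2 = 4\<close> h(2) by simp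
    also have "\<dots> \<le> 4 * (1 * lam * h\<^sup>2)" using par by (intro mult_left_mono mult_right_mono) auto
    also have "\<dots> = lam * (2 * h)\<^sup>2" by (simp add: power_mult_distrib)
    finally show "T\<^sup>2 \<le> (2 * h)\<^sup>2" using par by simp
  qed (use h in simp)
  have AB: "A \<subseteq> B_V V (\<delta> * lam)"
    using h unfolding A_def B_V_inner_def by (auto simp: subset_iff)
  have fin: "finite J"
    unfolding J_def by (rule finite_cell_index[OF s bounded_subset[OF bd AB]])
  have inside: "ball (cell_centre s j) (4 * h + T) \<subseteq> B_V V (\<delta> * lam)" if "j \<in> J" for j
  proof
    fix y assume y: "y \<in> ball (cell_centre s j) (4 * h + T)"
    obtain x where x: "x \<in> A" "j = cell_index s x" using \<open>j \<in> J\<close> by (auto simp: J_def)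
    \<comment> \<open>Each coordinate of \<open>y\<close> is within \<open>6 * h\<close>, so within
      \<open>s / 2\<close>, of that of the centre, and likewise for \<open>x\<close>. Adding the two
      coordinates gives distance at most \<open>2 * s = 25 * h < \<rho>\<close>.\<close>
    have "\<bar>(x - y) $ i\<bar> \<le> s" for i
    proof -
      have "\<bar>(cell_centre s j - y) $ i\<bar> \<le> s / 2"
        using y component_le_norm_cart[of "cell_centre s j - y" i] \<open>T \<le> 2 * h\<close> h
        by (simp add: dist_norm s_def)
      then show ?thesis
        using abs_diff_cell_centre[OF s, of x i] unfolding x(2) vector_minus_component by linarith
    qed
    from this[of 1] this[of 2] have "dist x y < \<rho>"
      using norm_le_vec2[of "x - y"] h(3) unfolding s_def dist_norm by linarith
    then show "y \<in> B_V V (\<delta> * lam)" using x(1) by (auto simp: A_def B_V_inner_def)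
  qed
  have Vlt: "V x < \<delta> * lam" if "j \<in> J" "dist (cell_centre s j) x < 4 * h + T" for j x
    using inside[OF that(1)] that(2) by (auto simp: B_V_def)
  have "\<exists>z. dist (cell_centre s j) z < 4 * h \<and> u z = 0" if "j \<in> J" for j
  proof -
    have "\<exists>x\<in>ball (cell_centre s j) (4 * h). u x = 0"
    proof (rule eigenfunction_zero_in_ball[OF ef V(2), of _ "(1 - \<delta>) * lam"])
      show "(1 - \<delta>) * lam < lam - V x" if "x \<in> ball (cell_centre s j) (4 * h)" for x
        using Vlt[OF \<open>j \<in> J\<close>, of x] that T0 by (simp add: algebra_simps)
    qed (use h in \<open>auto simp: power_mult_distrib\<close>)
    then show ?thesis by auto
  qed
  then obtain z where z: "\<And>j. j \<in> J \<Longrightarrow> dist (cell_centre s j) (z j) < 4 * h" "\<And>j. j \<in> J \<Longrightarrow> u (z j) = 0"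
    by metis
  define P where "P j = nodal_set u \<inter> ball (cell_centre s j) (4 * h + T)" for j
  have len: "of_nat (card J) * ennreal T \<le> hausdorff_length (nodal_set u \<inter> B_V V (\<delta> * lam))"
  proof (rule hausdorff_length_ge_separated[OF fin, where P = P and g = "\<lambda>j x. dist x (z j)" and sep = "h / 2"])
    show "P j \<subseteq> nodal_set u \<inter> B_V V (\<delta> * lam)" if "j \<in> J" for j
      using inside[OF that] by (auto simp: P_def)
    show "\<bar>dist x (z j) - dist y (z j)\<bar> \<le> dist x y" for j x y
      by (metis abs_dist_diff_le dist_commute)
    \<comment> \<open>Every radius below \<open>T\<close> is the distance from \<open>z j\<close> to
      some zero, so the distance function maps the piece onto a set of length at least
      \<open>T\<close>.\<close>
    show "{0<..<T} \<subseteq> (\<lambda>x. dist x (z j)) ` P j" if j: "j \<in> J" for j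
    proof
      fix t assume t: "t \<in> {0<..<T}"
      have close: "dist (cell_centre s j) x < 4 * h + T" if "dist x (z j) \<le> t" for x
        using that t z(1)[OF j] dist_triangle[of "cell_centre s j" x "z j"] by (simp add: dist_commute)
      have "lam * t\<^sup>2 < 4"
        using t par power_strict_mono[of t T 2] \<open>lam * T\<^sup>2 = 4\<close>
        by (metis greaterThanLessThan_iff less_imp_le mult_strict_left_mono pos2)
      moreover have "0 \<le> V x \<and> V x \<le> lam" if "x \<in> cball (z j) t" for x
      proof -
        have "V x < \<delta> * lam" using that by (intro Vlt[OF j] close) (simp add: dist_commute)
        also have "\<dots> \<le> 1 * lam" using par by (intro mult_right_mono) auto
        finally show ?thesis using V(1)[of x] by simp
      qed
      ultimately obtain x where x: "dist x (z j) = t" "u x = 0"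
        using eigenfunction_zero_on_sphere[OF ef V(2), of t "z j"] t par z(2)[OF j] by auto
      have "x \<in> nodal_set u" unfolding nodal_set_def using x(2) closure_subset[of "{x. u x = 0}"] by auto
      then have "x \<in> P j" using close[of x] x(1) by (simp add: P_def)
      then show "t \<in> (\<lambda>x. dist x (z j)) ` P j" using x(1) by blast
    qed
    show "h / 2 < dist x y" if "j \<noteq> k" "x \<in> P j" "y \<in> P k" for j k x y
    proof -
      have "dist (cell_centre s j) x < 6 * h" "dist (cell_centre s k) y < 6 * h"
        using that(2,3) \<open>T \<le> 2 * h\<close> by (auto simp: P_def)
      moreover have "25 / 2 * h \<le> dist (cell_centre s j) (cell_centre s k)"
        using dist_cell_centre_ge[OF s that(1)] by (simp add: s_def)
      moreover have "dist (cell_centre s j) (cell_centre s k)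
          \<le> dist (cell_centre s j) x + dist x y + dist (cell_centre s k) y"
        using dist_triangle[of "cell_centre s j" "cell_centre s k" x] dist_triangle[of x "cell_centre s k" y]
        by (simp add: dist_commute)
      ultimately show ?thesis using h(1) by linarith
    qed
  qed (use h in simp)
  have "ennreal (T / s\<^sup>2) * emeasure lebesgue A \<le> ennreal (T / s\<^sup>2) * (of_nat (card J) * ennreal (s\<^sup>2))"
    unfolding J_def by (intro mult_left_mono emeasure_le_cells[OF s fin[unfolded J_def]]) simp
  also have "\<dots> = of_nat (card J) * (ennreal (T / s\<^sup>2) * ennreal (s\<^sup>2))" by (simp add: mult_ac)
  also have "ennreal (T / s\<^sup>2) * ennreal (s\<^sup>2) = ennreal T"
    using s T0 by (simp flip: ennreal_mult)
  finally show ?thesis using len unfolding A_def T_def s_def by (rule order_trans)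
qed

lemma bounded_B_V:
  fixes V :: "real^'n::finite \<Rightarrow> real"
  assumes "filterlim V at_top at_infinity"
  shows "bounded (B_V V \<mu>)"
proof -
  have "eventually (\<lambda>x. \<mu> \<le> V x) at_infinity" using assms by (simp add: filterlim_at_top)
  then obtain b where "\<And>x. b \<le> norm x \<Longrightarrow> \<mu> \<le> V x" unfolding eventually_at_infinity by auto
  then have "norm x \<le> b" if "x \<in> B_V V \<mu>" for x
    using that by (cases "b \<le> norm x") (auto simp: B_V_def not_less[symmetric])
  then show ?thesis unfolding bounded_iff by blast
qed

theorem proposition7p2:
  fixes V :: "real^2 \<Rightarrow> real" and \<delta> \<rho> :: real
  assumes "\<And>x. 0 < V x"
    and "continuous_on UNIV V"
    and "filterlim V at_top at_infinity"
    and "0 < \<delta>" "\<delta> < 1"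
    and "0 < \<rho>" "\<rho> \<le> 1"
  shows "\<forall>\<^sub>F lam in at_top. \<forall>u. eigenfunction V lam u \<longrightarrow>
    ennreal (2 * (1 - \<delta>) / (9 * pi\<^sup>2 * j01) * sqrt lam)
        * emeasure lebesgue (B_V_inner V (2 * \<rho>) (\<delta> * lam))
      \<le> hausdorff_length (nodal_set u \<inter> B_V V (\<delta> * lam))"
proof (rule eventually_mono[OF eventually_gt_at_top[of "(25 / (2 * \<rho>))\<^sup>2 / (1 - \<delta>)"]], intro allI impI)
  fix lam u
  assume lam: "(25 / (2 * \<rho>))\<^sup>2 / (1 - \<delta>) < lam" and ef: "eigenfunction V lam u"
  have large: "(25 / (2 * \<rho>))\<^sup>2 < (1 - \<delta>) * lam" using lam assms(5) by (simp add: pos_divide_less_eq mult.commute)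
  have "0 \<le> (25 / (2 * \<rho>))\<^sup>2 / (1 - \<delta>)" using assms(5) by simp
  then have lam0: "0 < lam" using lam by linarith
  define k where "k = (1 - \<delta>) * lam"
  have k: "0 < k" using assms(5) lam0 by (simp add: k_def)
  define h where "h = 1 / sqrt k"
  have h: "0 < h" "k * h\<^sup>2 = 1" using k by (simp_all add: h_def power_divide)
  \<comment> \<open>The threshold for \<open>lam\<close> is exactly the condition
    \<open>25 * h < 2 * \<rho>\<close> of \<open>nodal_length_ge\<close> with inner radius
    \<open>2 * \<rho>\<close>.\<close>
  have "25 / (2 * \<rho>) < sqrt k" using large unfolding k_def by (rule real_less_rsqrt)
  then have "25 * h < 2 * \<rho>" using assms(6) k by (simp add: h_def field_simps)
  note main = nodal_length_ge[OF assms(1,2) bounded_B_V[OF assms(3)] assms(4,5) lam0 h[unfolded k_def] this ef]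
  have "2 * (1 - \<delta>) / (9 * pi\<^sup>2 * j01) * sqrt lam \<le> 2 / sqrt lam / (25 / 2 * h)\<^sup>2"
  proof -
    \<comment> \<open>The margin in the constants: \<open>9 * 9 * 2 = 162\<close> exceeds
      \<open>(25 / 2)^2 = 156.25\<close>, the area of a cell in units of
      \<open>h\<^sup>2\<close>.\<close>
    have "9 * 9 * 2 \<le> 9 * pi\<^sup>2 * j01"
    proof (intro mult_mono)
      show "(9::real) \<le> pi\<^sup>2" using power_mono[of 3 pi 2] pi_gt3 by simp
    qed (use j01_ge_2 in auto)
    then have "625 / 4 \<le> 9 * pi\<^sup>2 * j01" by linarith
    then have "2 * (1 - \<delta>) / (9 * pi\<^sup>2 * j01) * sqrt lam \<le> 2 * (1 - \<delta>) / (625 / 4) * sqrt lam"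
      using assms(5) lam0 by (intro mult_right_mono divide_left_mono) auto
    also have "\<dots> = 2 / sqrt lam / (25 / 2 * h)\<^sup>2"
    proof -
      have "h\<^sup>2 = 1 / k" using k by (simp add: h_def power_divide)
      then have "2 / sqrt lam / (25 / 2 * h)\<^sup>2 = 2 * (1 - \<delta>) / (625 / 4) * (lam / sqrt lam)"
        by (simp add: power_mult_distrib power_divide k_def) (simp add: algebra_simps)
      then show ?thesis using real_div_sqrt[of lam] lam0 by simp
    qed
    finally show ?thesis .
  qed
  then have "ennreal (2 * (1 - \<delta>) / (9 * pi\<^sup>2 * j01) * sqrt lam)
        * emeasure lebesgue (B_V_inner V (2 * \<rho>) (\<delta> * lam))
      \<le> ennreal (2 / sqrt lam / (25 / 2 * h)\<^sup>2) * emeasure lebesgue (B_V_inner V (2 * \<rho>) (\<delta> * lam))"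
    by (intro mult_right_mono ennreal_leI) auto
  also note main
  finally show "ennreal (2 * (1 - \<delta>) / (9 * pi\<^sup>2 * j01) * sqrt lam)
        * emeasure lebesgue (B_V_inner V (2 * \<rho>) (\<delta> * lam))
      \<le> hausdorff_length (nodal_set u \<inter> B_V V (\<delta> * lam))" .
qed

end
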